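(* Let $n,s$ be positive integers. Let $\chi_1,\Psi_1$ (for $x>0$), $\chi_2,\Psi_2$ (for $x<0$), the interval $(x_l,x_r)$, the value $h_0$, the arcs $\Gamma_h^{\pm}$ ($h\in(0,h_0)$) and the involution $\sigma$ associated with $\Psi_1$ and $\Psi_2$ be as described in the context. Let $f_{10},f_{11},\dots,f_{1(n-1)}$ be real analytic functions on $(0,x_r)$ and $f_{20},f_{21},\dots,f_{2(n-1)}$ real analytic functions on $(x_l,0)$, such that for $i=0,1,\dots,n-1$ the line integrals $$I_i(h)=\int_{\Gamma_h^+}f_{1i}(x)\,y^{2s-1}\,dx,\qquad J_i(h)=\int_{\Gamma_h^-}f_{2i}(x)\,y^{2s-1}\,dx$$ converge absolutely for every $h\in(0,h_0)$. For $i=0,1,\dots,2n-1$ define, for $h\in(0,h_0)$, $$L_i(h)=\begin{cases} I_{i/2}(h), & i=0,2,\dots,2n-2,\\ J_{(i-1)/2}(h), & i=1,3,\dots,2n-1,\end{cases}$$ and, for $x\in(0,x_r)$, $$l_i(x)=\begin{cases}\left(\dfrac{f_{1(i/2)}}{\chi_1^{(2s-1)/2}}\right)(x), & i=0,2,\dots,2n-2,\\[3mm] -\left(\dfrac{f_{2((i-1)/2)}}{\chi_2^{(2s-1)/2}}\right)(\sigma(x))\,\sigma'(x), & i=1,3,\dots,2n-1.\end{cases}$$ If $\{l_0,l_1,\dots,l_{2n-1}\}$ is a CT-system on $(0,x_r)$ and $s>2(n-1)$, then $\{L_0,L_1,\dots,L_{2n-1}\}$ is an ECT-system on $(0,h_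0)$.
   Context: Setting. Let $x_l<0<x_r$. Consider the piecewise Hamiltonian function $H(x,y)=H^+(x,y)=\chi_1(x)y^2+\Psi_1(x)$ for $x>0$ and $H(x,y)=H^-(x,y)=\chi_2(x)y^2+\Psi_2(x)$ for $x<0$, where $H^{\pm}$ are real analytic on an open subset of the plane (so $\chi_1,\Psi_1$ are analytic on $[0,x_r)$ and $\chi_2,\Psi_2$ are analytic on $(x_l,0]$), $\Psi_1(0)=\Psi_2(0)=0$, $x\Psi_1'(x)>0$ and $\chi_1(x)>0$ for all $x\in(0,x_r)$, $x\Psi_2'(x)>0$ and $\chi_2(x)>0$ for all $x\in(x_l,0)$, and $\lim_{x\to0^+}\chi_1(x)=\lim_{x\to0^-}\chi_2(x)>0$. The interval $(x_l,x_r)$ is the projection onto the $x$-axis of the family of (non-smooth) ovals of $H$ around the origin, and $h_0>0$ is the corresponding limit value of the energy: $\lim_{x\to x_r^-}\Psi_1(x)=\lim_{x\to x_l^+}\Psi_2(x)=h_0$. Arcs. For $h\in(0,h_0)$, $\Gamma_h^+=\{\chi_1(x)y^2+\Psi_1(x)=h,\ 0<x<x_r\}$ and $\Gamma_h^-=\{\chi_2(x)y^2+\Psi_2(x)=h,\ x_l<x<0\}$; $\Gamma_h^+\cup\Gamma_h^-$ (completed by its two points on the $y$-axis) is an oval around the origin, oriented clockwise. Thus $\Gamma_h^+$ runs from the positive $y$-axis to the negative $y$-axis in $x>0$, and $\Gamma_h^-$ runs from the negative $y$-axis to the positive $y$-axis in $x<0$. Involution. $\sigma:(x_l,x_r)\to(x_l,x_r)$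 is defined by $\sigma(0)=0$; for $x\in(0,x_r)$, $\sigma(x)\in(x_l,0)$ is the unique point with $\Psi_2(\sigma(x))=\Psi_1(x)$; for $x\in(x_l,0)$, $\sigma(x)\in(0,x_r)$ is the unique point with $\Psi_1(\sigma(x))=\Psi_2(x)$. It satisfies $\sigma\circ\sigma=\mathrm{Id}$ and is analytic on $(0,x_r)$ and on $(x_l,0)$. Chebyshev systems. Let $g_0,\dots,g_{N-1}$ be real analytic on an open interval $\mathbb I$. The ordered set $\{g_0,\dots,g_{N-1}\}$ is a CT-system (complete Chebyshev system) on $\mathbb I$ if for every $k=1,\dots,N$ every nontrivial linear combination of $g_0,\dots,g_{k-1}$ has at most $k-1$ zeros on $\mathbb I$ (in particular is not identically zero); equivalently, for every $k=1,\dots,N$, $\det(g_j(x_i))_{0\le i,j\le k-1}\neq0$ for all pairwise distinct $x_0,\dots,x_{k-1}\in\mathbb I$. It is an ECT-system (extended complete Chebyshev system) on $\mathbb I$ if for every $k=1,\dots,N$ every nontrivial linear combination of $g_0,\dots,g_{k-1}$ has at most $k-1$ zeros on $\mathbb I$ counted with multiplicity; equivalently, for every $k=1,\dots,N$, the Wronskian $\det(g_j^{(i)}(x))_{0\le i,j\le k-1}\ne0$ for all $x\in\mathbb I$. *)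

theory Defs
  imports "HOL-Analysis.Analysis"
begin

(* S is meant to be an interval. The expansion is only tested at points of S, so at an endpoint
   belonging to S the condition is one-sided; a power series that converges on one side converges
   on both, so this is the same as having an analytic extension to a neighbourhood of S. *)
definition real_analytic_on :: "(real \<Rightarrow> real) \<Rightarrow> real set \<Rightarrow> bool" where
  "real_analytic_on f S \<longleftrightarrow>
     (\<forall>x\<in>S. \<exists>r>0. \<exists>a. \<forall>y\<in>S. \<bar>y - x\<bar> < r \<longrightarrow> (\<lambda>n. a n * (y - x) ^ n) sums f y)"

(* The systems below are g 0, ..., g (N - 1); a nontrivial combination of g 0, ..., g (k - 1) is
   given by coefficients c of which only c 0, ..., c (k - 1) matter. *)
definition CT_system :: "nat \<Rightarrow> (nat \<Rightarrow> real \<Rightarrow> real) \<Rightarrow> real set \<Rightarrow> bool" where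
  "CT_system N g S \<longleftrightarrow>
     (\<forall>j<N. real_analytic_on (g j) S) \<and>
     (\<forall>k\<in>{1..N}. \<forall>c. (\<exists>j<k. c j \<noteq> 0) \<longrightarrow>
        finite {x\<in>S. (\<Sum>j<k. c j * g j x) = 0} \<and>
        card {x\<in>S. (\<Sum>j<k. c j * g j x) = 0} \<le> k - 1)"

(* Only meaningful where f is analytic and not locally zero, which holds wherever it is used in
   ECT_system: there the zeros are finite in number, hence isolated. *)
definition zero_multiplicity :: "(real \<Rightarrow> real) \<Rightarrow> real \<Rightarrow> nat" where
  "zero_multiplicity f x = (LEAST m. (deriv ^^ m) f x \<noteq> 0)"

definition ECT_system :: "nat \<Rightarrow> (nat \<Rightarrow> real \<Rightarrow> real) \<Rightarrow> real set \<Rightarrow> bool" where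
  "ECT_system N g S \<longleftrightarrow>
     (\<forall>j<N. real_analytic_on (g j) S) \<and>
     (\<forall>k\<in>{1..N}. \<forall>c. (\<exists>j<k. c j \<noteq> 0) \<longrightarrow>
        (let f = (\<lambda>x. \<Sum>j<k. c j * g j x); Z = {x\<in>S. f x = 0}
         in finite Z \<and> (\<Sum>x\<in>Z. zero_multiplicity f x) \<le> k - 1))"

definition level_arc :: "ereal \<Rightarrow> ereal \<Rightarrow> (real \<Rightarrow> real) \<Rightarrow> (real \<Rightarrow> real) \<Rightarrow> real \<Rightarrow> (real \<times> real) set" where
  "level_arc a b chi \<Psi> h = {(x, y). x \<in> einterval a b \<and> chi x * y\<^sup>2 + \<Psi> x = h}"

definition pos_y_axis :: "(real \<times> real) set" where
  "pos_y_axis = {(0, y) | y. y > 0}"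

definition neg_y_axis :: "(real \<times> real) set" where
  "neg_y_axis = {(0, y) | y. y < 0}"

(* The endpoints of the path are the two points completing the open arc \<Gamma>. *)
definition parametrizes_arc ::
  "(real \<Rightarrow> real \<times> real) \<Rightarrow> (real \<times> real) set \<Rightarrow> (real \<times> real) set \<Rightarrow> (real \<times> real) set \<Rightarrow> bool" where
  "parametrizes_arc \<gamma> \<Gamma> A B \<longleftrightarrow>
     valid_path \<gamma> \<and> arc \<gamma> \<and> \<gamma> ` {0<..<1} = \<Gamma> \<and> pathstart \<gamma> \<in> A \<and> pathfinish \<gamma> \<in> B"

(* Pull-back by \<gamma> of the 1-form P dx. *)
definition dx_pullback :: "(real \<times> real \<Rightarrow> real) \<Rightarrow> (real \<Rightarrow> real \<times> real) \<Rightarrow> real \<Rightarrow> real" where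
  "dx_pullback P \<gamma> t = P (\<gamma> t) * fst (vector_derivative \<gamma> (at t within {0..1}))"

definition line_integral_dx_converges_absolutely ::
  "(real \<times> real \<Rightarrow> real) \<Rightarrow> (real \<Rightarrow> real \<times> real) \<Rightarrow> bool" where
  "line_integral_dx_converges_absolutely P \<gamma> \<longleftrightarrow> dx_pullback P \<gamma> absolutely_integrable_on {0..1}"

definition line_integral_dx :: "(real \<times> real \<Rightarrow> real) \<Rightarrow> (real \<Rightarrow> real \<times> real) \<Rightarrow> real" where
  "line_integral_dx P \<gamma> = integral {0..1} (dx_pullback P \<gamma>)"

definition involution ::
  "ereal \<Rightarrow> ereal \<Rightarrow> (real \<Rightarrow> real) \<Rightarrow> (real \<Rightarrow> real) \<Rightarrow> real \<Rightarrow> real" where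
  "involution x\<^sub>l x\<^sub>r \<Psi>\<^sub>1 \<Psi>\<^sub>2 x =
     (if x = 0 then 0
      else if 0 < x then (THE u. u \<in> einterval x\<^sub>l 0 \<and> \<Psi>\<^sub>2 u = \<Psi>\<^sub>1 x)
      else (THE u. u \<in> einterval 0 x\<^sub>r \<and> \<Psi>\<^sub>1 u = \<Psi>\<^sub>2 x))"

end

theory Submission
  imports Defs "HOL-Complex_Analysis.Complex_Analysis"
begin

text \<open>Both families of integrals become Abel-type integrals in the energy: on each half of a right arc
  the substitution \<open>v = \<Psi>\<^sub>1 x\<close> is injective, and on a left arc so is \<open>v = \<Psi>\<^sub>2 x\<close>, and this gives
  \<open>L\<^sub>i h = 2 * \<integral>\<^sub>0\<^sup>h g\<^sub>i v * (h - v) powr a dv\<close> with \<open>a = s - 1/2\<close> and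
  \<open>l\<^sub>i x = g\<^sub>i (\<Psi>\<^sub>1 x) * \<Psi>\<^sub>1' x\<close>, so that the \<open>g\<^sub>i\<close> inherit the bound on the number of zeros.
  Differentiating \<open>i\<close> times lowers the exponent to \<open>a - i\<close>, which is integrable in the range
  needed because \<open>s > 2 * (n - 1)\<close>. If a nontrivial combination of the first \<open>k\<close> functions vanished
  to order \<open>k\<close> at \<open>h\<close>, the corresponding combination \<open>\<phi>\<close> of the \<open>g\<^sub>i\<close> would be orthogonal on \<open>(0, h)\<close>,
  with weight \<open>(h - v) powr (a - k + 1)\<close>, to all polynomials of degree less than \<open>k\<close>; but \<open>\<phi>\<close> has at
  most \<open>k - 1\<close> zeros, so one of these polynomials has its sign changes. This pointwise nondegeneracy
  implies the global count with multiplicities by dividing by the first function, differentiating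
  and applying Rolle's theorem.\<close>

section \<open>Analytic functions of a real variable\<close>

text \<open>Where the bound on \<open>s\<close> enters: for N = 2n functions, order N at a point is
  tested by derivatives of order 0, ..., N - 1. The last carries the exponent a - (N - 1), which
  must exceed -1, and s >= 2n - 1 gives a >= 2n - 3/2 > N - 2. As \<open>a\<close> is half an odd
  integer, no factor a - q produced by differentiation is zero, so vanishing derivatives do give
  vanishing integrals. The obstacle is regularity. The g_i are integrable near 0 but analytic only
  on the open energy interval, and the kernel is singular at the moving endpoint v = h, so
  differentiation under the integral sign is delicate there. Each integral is therefore cut at a
  fixed b < h close to h. Below b the kernel is expanded in a binomial series; above b it is g that
  is expanded, and termwise integration produces Beta values. This gives both analyticity and the
  rule for the derivative. The exponents a - i, i < k, are a - k + 1 plus 0, ..., k - 1; this is how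
  polynomials in h - v arise. Left arcs are carried to right arcs by (x, y) -> (-x, -y), which keeps
  the orientation and, since 2s - 1 is odd, the integrand.\<close>

text \<open>Phrased through a holomorphic extension so that products, quotients, composition and
  inverse functions come from complex analysis instead of manipulations of power series.\<close>

definition real_analytic_at :: "(real \<Rightarrow> real) \<Rightarrow> real \<Rightarrow> bool" where
  "real_analytic_at f x \<longleftrightarrow> (\<exists>F. F analytic_on {complex_of_real x} \<and>
     (\<forall>\<^sub>F y in nhds x. F (of_real y) = of_real (f y)))"

lemma real_analytic_atI:
  assumes "F holomorphic_on U" "open U" "complex_of_real x \<in> U"
    and "\<forall>\<^sub>F y in nhds x. F (of_real y) = of_real (f y)"
  shows "real_analytic_at f x"
  unfolding real_analytic_at_def using assms analytic_at by blast

lemma real_analytic_atE: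
  assumes "real_analytic_at f x"
  obtains r F where "r > 0" "F holomorphic_on ball (complex_of_real x) r"
    "\<And>y. \<bar>y - x\<bar> < r \<Longrightarrow> F (of_real y) = of_real (f y)"
proof -
  obtain F where F: "F analytic_on {complex_of_real x}" "\<forall>\<^sub>F y in nhds x. F (of_real y) = of_real (f y)"
    using assms unfolding real_analytic_at_def by blast
  obtain e where e: "e > 0" "F holomorphic_on ball (complex_of_real x) e"
    using F(1) by (meson analytic_on_def singletonI)
  obtain d where d: "d > 0" "\<And>y. dist y x < d \<Longrightarrow> F (of_real y) = of_real (f y)"
    using F(2) unfolding eventually_nhds_metric by blast
  show ?thesis
    by (rule that[of "min d e" F]) (use d e in \<open>auto intro: holomorphic_on_subset simp: dist_real_def\<close>)
qed

lemma real_analytic_at_nearby: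
  assumes "real_analytic_at f x"
  shows "\<forall>\<^sub>F y in nhds x. real_analytic_at f y"
proof -
  obtain r F where F: "r > 0" "F holomorphic_on ball (complex_of_real x) r"
    "\<And>y. \<bar>y - x\<bar> < r \<Longrightarrow> F (of_real y) = of_real (f y)"
    using real_analytic_atE[OF assms] by metis
  have "real_analytic_at f y" if "dist y x < r" for y
  proof (rule real_analytic_atI[OF F(2) open_ball])
    show "complex_of_real y \<in> ball (complex_of_real x) r"
      using that by (metis dist_commute dist_of_real mem_ball)
    have "\<forall>\<^sub>F z in nhds y. dist z x < r"
      using that eventually_nhds_in_open[of "ball x r" y] by (simp add: dist_commute)
    then show "\<forall>\<^sub>F z in nhds y. F (of_real z) = of_real (f z)"
      by eventually_elim (auto simp: dist_real_def intro: F)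
  qed
  then show ?thesis
    using F(1) eventually_nhds_metric by blast
qed

lemma real_analytic_at_cong:
  assumes "real_analytic_at f x" "\<forall>\<^sub>F y in nhds x. g y = f y"
  shows "real_analytic_at g x"
proof -
  obtain F where F: "F analytic_on {complex_of_real x}" "\<forall>\<^sub>F y in nhds x. F (of_real y) = of_real (f y)"
    using assms unfolding real_analytic_at_def by blast
  have "\<forall>\<^sub>F y in nhds x. F (of_real y) = of_real (g y)"
    using F(2) assms(2) by eventually_elim auto
  then show ?thesis using F(1) unfolding real_analytic_at_def by blast
qed

lemma real_analytic_at_const [simp]: "real_analytic_at (\<lambda>_. c) x"
  unfolding real_analytic_at_def by (rule exI[of _ "\<lambda>_. of_real c"]) auto

lemma real_analytic_at_add:
  assumes "real_analytic_at f x" "real_analytic_at g x"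
  shows "real_analytic_at (\<lambda>y. f y + g y) x"
proof -
  obtain F G where "F analytic_on {complex_of_real x}" "\<forall>\<^sub>F y in nhds x. F (of_real y) = of_real (f y)"
    "G analytic_on {complex_of_real x}" "\<forall>\<^sub>F y in nhds x. G (of_real y) = of_real (g y)"
    using assms unfolding real_analytic_at_def by blast
  then show ?thesis unfolding real_analytic_at_def
    by (intro exI[of _ "\<lambda>z. F z + G z"] conjI analytic_on_add) (auto elim: eventually_elim2)
qed

lemma real_analytic_at_mult:
  assumes "real_analytic_at f x" "real_analytic_at g x"
  shows "real_analytic_at (\<lambda>y. f y * g y) x"
proof -
  obtain F G where "F analytic_on {complex_of_real x}" "\<forall>\<^sub>F y in nhds x. F (of_real y) = of_real (f y)"
    "G analytic_on {complex_of_real x}" "\<forall>\<^sub>F y in nhds x. G (of_real y) = of_real (g y)"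
    using assms unfolding real_analytic_at_def by blast
  then show ?thesis unfolding real_analytic_at_def
    by (intro exI[of _ "\<lambda>z. F z * G z"] conjI analytic_on_mult) (auto elim: eventually_elim2)
qed

lemma real_analytic_at_divide:
  assumes "real_analytic_at f x" "real_analytic_at g x" "g x \<noteq> 0"
  shows "real_analytic_at (\<lambda>y. f y / g y) x"
proof -
  obtain F G where *: "F analytic_on {complex_of_real x}" "\<forall>\<^sub>F y in nhds x. F (of_real y) = of_real (f y)"
    "G analytic_on {complex_of_real x}" "\<forall>\<^sub>F y in nhds x. G (of_real y) = of_real (g y)"
    using assms unfolding real_analytic_at_def by blast
  have "G (of_real x) \<noteq> 0"
    using eventually_nhds_x_imp_x[OF *(4)] assms(3) by simp
  with * show ?thesis unfolding real_analytic_at_def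
    by (intro exI[of _ "\<lambda>z. F z / G z"] conjI analytic_on_divide) (auto elim: eventually_elim2)
qed

lemma real_analytic_at_sum:
  assumes "\<And>j. j \<in> A \<Longrightarrow> real_analytic_at (f j) x"
  shows "real_analytic_at (\<lambda>y. \<Sum>j\<in>A. c j * f j y) x"
  using assms
  by (induction A rule: infinite_finite_induct) (auto intro!: real_analytic_at_add real_analytic_at_mult)

text \<open>The derivative of the extension is real at real points, hence it is itself an extension
  of the real derivative.\<close>

lemma deriv_complex_extension:
  assumes "F holomorphic_on ball (complex_of_real x) r"
    and eq: "\<And>y. \<bar>y - x\<bar> < r \<Longrightarrow> F (of_real y) = of_real (f y)"
    and y: "\<bar>y - x\<bar> < r"
  shows "(f has_real_derivative deriv f y) (at y)" "deriv F (of_real y) = of_real (deriv f y)"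
proof -
  have "complex_of_real y \<in> ball (of_real x) r"
    using y by (metis abs_minus_commute dist_of_real dist_real_def mem_ball)
  then have "(F has_field_derivative deriv F (of_real y)) (at (of_real y))"
    by (meson assms(1) holomorphic_derivI open_ball)
  then have "((\<lambda>u. F (of_real u)) has_vector_derivative deriv F (of_real y)) (at y)"
    by (rule has_vector_derivative_real_field)
  then have v: "((\<lambda>u. complex_of_real (f u)) has_vector_derivative deriv F (of_real y)) (at y)"
    by (rule has_vector_derivative_transform_within_open[where S = "ball x r"])
      (use y eq in \<open>auto simp: dist_real_def abs_minus_commute\<close>)
  have d: "(f has_real_derivative Re (deriv F (of_real y))) (at y)"
    using bounded_linear.has_vector_derivative[OF bounded_linear_Re v]
    by (simp add: has_real_derivative_iff_has_vector_derivative)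
  \<comment> \<open>The zero function is the imaginary part of the real-valued curve
    \<open>f\<close>; uniqueness of derivatives makes the imaginary part of \<open>deriv F\<close>
    vanish.\<close>
  have "((\<lambda>u. 0) has_vector_derivative Im (deriv F (of_real y))) (at y)"
    using bounded_linear.has_vector_derivative[OF bounded_linear_Im v] by simp
  then have "Im (deriv F (of_real y)) = 0"
    using vector_derivative_unique_at has_vector_derivative_const by blast
  with d show "(f has_real_derivative deriv f y) (at y)" "deriv F (of_real y) = of_real (deriv f y)"
    using DERIV_imp_deriv[OF d] by (auto simp add: complex_eq_iff)
qed

lemma real_analytic_at_has_deriv:
  assumes "real_analytic_at f x"
  shows "(f has_real_derivative deriv f x) (at x)" "real_analytic_at (deriv f) x"
proof -
  obtain r F where F: "r > 0" "F holomorphic_on ball (complex_of_real x) r"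
    "\<And>y. \<bar>y - x\<bar> < r \<Longrightarrow> F (of_real y) = of_real (f y)"
    using real_analytic_atE[OF assms] by metis
  note * = deriv_complex_extension[OF F(2,3)]
  show "(f has_real_derivative deriv f x) (at x)"
    using *(1)[of x] F(1) by simp
  have "\<forall>\<^sub>F y in nhds x. deriv F (of_real y) = of_real (deriv f y)"
    unfolding eventually_nhds_metric using *(2) F(1) by (auto simp: dist_real_def)
  with F(1) show "real_analytic_at (deriv f) x"
    by (intro real_analytic_atI[OF holomorphic_deriv[OF F(2) open_ball] open_ball]) auto
qed

lemma real_analytic_at_isCont: "real_analytic_at f x \<Longrightarrow> isCont f x"
  using DERIV_isCont real_analytic_at_has_deriv(1) by blast

lemma real_analytic_at_compose:
  assumes "real_analytic_at g x" "real_analytic_at f (g x)"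
  shows "real_analytic_at (\<lambda>y. f (g y)) x"
proof -
  obtain F G where *: "F analytic_on {complex_of_real (g x)}" "\<forall>\<^sub>F y in nhds (g x). F (of_real y) = of_real (f y)"
    "G analytic_on {complex_of_real x}" "\<forall>\<^sub>F y in nhds x. G (of_real y) = of_real (g y)"
    using assms unfolding real_analytic_at_def by blast
  have Gx: "G (of_real x) = of_real (g x)"
    using eventually_nhds_x_imp_x[OF *(4)] by simp
  have "(\<lambda>z. F (G z)) analytic_on {complex_of_real x}"
    using analytic_on_compose[OF *(3), of F] *(1) Gx by (simp add: o_def)
  moreover have "\<forall>\<^sub>F y in nhds x. F (of_real (g y)) = of_real (f (g y))"
    by (rule eventually_compose_filterlim[OF *(2)])
      (use real_analytic_at_isCont[OF assms(1)] in \<open>simp add: isCont_def tendsto_at_iff_tendsto_nhds\<close>)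
  then have "\<forall>\<^sub>F y in nhds x. F (G (of_real y)) = of_real (f (g y))"
    using *(4) by eventually_elim auto
  ultimately show ?thesis unfolding real_analytic_at_def by (intro exI conjI)
qed

text \<open>Convergence at a real \<open>t\<close> of larger modulus forces convergence at complex
  points, so the same coefficients define a holomorphic function on the disc of radius
  \<open>r\<close>.\<close>

lemma power_series_real_analytic_at:
  assumes "\<And>t. \<bar>t\<bar> < r \<Longrightarrow> (\<lambda>n. a n * t ^ n) sums f (x + t)" "\<bar>y - x\<bar> < r"
  shows "real_analytic_at f y"
proof -
  define F where "F = (\<lambda>z. \<Sum>n. complex_of_real (a n) * (z - of_real x) ^ n)"
  have sumC: "(\<lambda>n. complex_of_real (a n) * (z - of_real x) ^ n) sums F z" if "z \<in> ball (of_real x) r" for z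
  proof -
    obtain t where t: "norm (z - of_real x) < t" "t < r"
      using \<open>z \<in> ball (of_real x) r\<close> dense by (metis dist_commute dist_norm mem_ball)
    have "0 \<le> norm (z - of_real x)" by simp
    with t have "\<bar>t\<bar> < r" by linarith
    then have "summable (\<lambda>n. a n * t ^ n)" using assms(1) sums_summable by blast
    then have "summable (\<lambda>n. complex_of_real (a n * t ^ n))" using summable_of_real by blast
    then have "summable (\<lambda>n. complex_of_real (a n) * of_real t ^ n)" by simp
    then show ?thesis unfolding F_def
      by (intro summable_sums) (rule powser_inside, use t in auto)
  qed
  have "F holomorphic_on ball (of_real x) r"
    by (rule power_series_holomorphic[of _ _ "\<lambda>n. complex_of_real (a n)"]) (rule sumC)
  moreover have "complex_of_real y \<in> ball (of_real x) r"
    using assms(2) by (metis abs_minus_commute dist_of_real dist_real_def mem_ball)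
  moreover have F: "F (of_real y) = of_real (f y)" if "\<bar>y - x\<bar> < r" for y
  proof -
    have "(\<lambda>n. complex_of_real (a n * (y-x) ^ n)) sums of_real (f (x + (y-x)))"
      using assms(1)[OF that] sums_of_real by blast
    then show ?thesis unfolding F_def by (simp add: sums_iff)
  qed
  have "\<forall>\<^sub>F z in nhds y. z \<in> ball x r"
    by (rule eventually_nhds_in_open) (use assms(2) in \<open>auto simp: dist_real_def\<close>)
  then have "\<forall>\<^sub>F z in nhds y. F (of_real z) = of_real (f z)"
    by eventually_elim (rule F, simp add: dist_real_def)
  ultimately show ?thesis
    by (intro real_analytic_atI[OF _ open_ball]) auto
qed

text \<open>Interior points only: elsewhere \<open>real_analytic_on\<close> tests the expansion on a
  part of the neighbourhood.\<close>

lemma real_analytic_on_imp_at: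
  assumes "real_analytic_on f S" "x \<in> interior S"
  shows "real_analytic_at f x"
proof -
  obtain e where e: "e > 0" "ball x e \<subseteq> S" using assms(2) mem_interior by blast
  then have "x \<in> S" by auto
  then obtain r a where r: "r > 0" "\<And>y. y \<in> S \<Longrightarrow> \<bar>y - x\<bar> < r \<Longrightarrow> (\<lambda>n. a n * (y - x) ^ n) sums f y"
    using assms(1) unfolding real_analytic_on_def by meson
  show ?thesis
  proof (rule power_series_real_analytic_at[of "min e r" a _ x])
    fix t :: real assume t: "\<bar>t\<bar> < min e r"
    then have "x + t \<in> S" using e(2) by (auto simp: subset_iff dist_real_def)
    then show "(\<lambda>n. a n * t ^ n) sums f (x + t)" using r(2)[of "x+t"] t by simp
  qed (use e r in auto)
qed

text \<open>The point is that the radius is uniform in the centre, which the definition of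
  \<open>real_analytic_on\<close> does not give directly.\<close>
lemma real_analytic_at_power_series_nearby:
  assumes "real_analytic_at f x"
  obtains r where "r > 0" "\<And>b. \<bar>b - x\<bar> < r \<Longrightarrow> \<exists>a. \<forall>t. \<bar>t\<bar> < r \<longrightarrow> (\<lambda>n. a n * t ^ n) sums f (b + t)"
proof -
  obtain r F where F: "r > 0" "F holomorphic_on ball (complex_of_real x) r"
    "\<And>y. \<bar>y - x\<bar> < r \<Longrightarrow> F (of_real y) = of_real (f y)"
    using real_analytic_atE[OF assms] by metis
  have "\<exists>a. \<forall>t. \<bar>t\<bar> < r/2 \<longrightarrow> (\<lambda>n. a n * t ^ n) sums f (b + t)" if b: "\<bar>b - x\<bar> < r/2" for b
  \<comment> \<open>Taylor coefficients of the extension at \<open>b\<close>. Their real parts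
    suffice, since the increment \<open>t\<close> and the value at b + t are real.\<close>
  proof (intro exI[of _ "\<lambda>n. Re ((deriv ^^ n) F (of_real b) / fact n)"] allI impI)
    fix t :: real assume t: "\<bar>t\<bar> < r/2"
    have "ball (complex_of_real b) (r/2) \<subseteq> ball (of_real x) r"
    proof
      fix z assume "z \<in> ball (complex_of_real b) (r/2)"
      then have "dist (of_real b) z < r/2" by simp
      moreover have "dist (complex_of_real b) (of_real x) < r/2"
        using b by (metis dist_of_real dist_real_def)
      ultimately show "z \<in> ball (of_real x) r"
        by (metis dist_commute dist_triangle_half_l mem_ball)
    qed
    then have "F holomorphic_on ball (complex_of_real b) (r/2)" using F(2) holomorphic_on_subset by blast
    moreover have "complex_of_real (b + t) \<in> ball (of_real b) (r/2)"
      using t by (metis abs_minus_cancel add_diff_cancel_left' dist_commute dist_of_real dist_real_def mem_ball)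
    ultimately have "(\<lambda>n. (deriv ^^ n) F (of_real b) / fact n * (of_real (b+t) - of_real b) ^ n) sums F (of_real (b+t))"
      by (rule holomorphic_power_series)
    then have "(\<lambda>n. Re ((deriv ^^ n) F (of_real b) / fact n * of_real (t ^ n))) sums Re (F (of_real (b+t)))"
      by (intro sums_Re) simp
    moreover have "F (of_real (b+t)) = of_real (f (b+t))" using F(3)[of "b+t"] b t by linarith
    ultimately show "(\<lambda>n. Re ((deriv ^^ n) F (of_real b) / fact n) * t ^ n) sums f (b + t)"
      by (simp only: Re_complex_of_real Re_complex_div_eq_0 times_complex.simps Im_complex_of_real) simp
  qed
  then show ?thesis using that[of "r/2"] F(1) by simp
qed

lemma real_analytic_onI:
  assumes "\<And>x. x \<in> S \<Longrightarrow> real_analytic_at f x"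
  shows "real_analytic_on f S"
  unfolding real_analytic_on_def
proof
  fix x assume "x \<in> S"
  then obtain r where r: "r > 0" "\<And>b. \<bar>b - x\<bar> < r \<Longrightarrow> \<exists>a. \<forall>t. \<bar>t\<bar> < r \<longrightarrow> (\<lambda>n. a n * t ^ n) sums f (b + t)"
    using real_analytic_at_power_series_nearby[OF assms] by metis
  then obtain a where a: "\<And>t. \<bar>t\<bar> < r \<Longrightarrow> (\<lambda>n. a n * t ^ n) sums f (x + t)" by force
  show "\<exists>r>0. \<exists>a. \<forall>y\<in>S. \<bar>y - x\<bar> < r \<longrightarrow> (\<lambda>n. a n * (y - x) ^ n) sums f y"
    using r(1) a[of "_ - x"] by (intro exI[of _ r] conjI exI[of _ a]) auto
qed

text \<open>Meant for the endpoint 0 of a half-closed interval. Convergence at one point y different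
  from x gives a positive radius of convergence, and the sum of the series is continuous at its
  centre.\<close>

lemma real_analytic_on_imp_continuous_on:
  assumes "real_analytic_on f S"
  shows "continuous_on S f"
  unfolding continuous_on_eq_continuous_within
proof
  fix x assume "x \<in> S"
  then obtain r a where r: "r > 0" "\<And>y. y \<in> S \<Longrightarrow> \<bar>y - x\<bar> < r \<Longrightarrow> (\<lambda>n. a n * (y - x) ^ n) sums f y"
    using assms unfolding real_analytic_on_def by meson
  show "continuous (at x within S) f"
  proof (cases "\<exists>y\<in>S. y \<noteq> x \<and> \<bar>y - x\<bar> < r")
    case True
    then obtain y where y: "y \<in> S" "y \<noteq> x" "\<bar>y - x\<bar> < r" by blast
    have "isCont (\<lambda>t. \<Sum>n. a n * t ^ n) 0"
      by (rule isCont_powser[of _ "y-x"]) (use r(2)[OF y(1,3)] y in \<open>auto simp: sums_iff\<close>)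
    then have "isCont (\<lambda>z. \<Sum>n. a n * (z - x) ^ n) x"
      using isCont_o2[of x "\<lambda>z. z - x" "\<lambda>t. \<Sum>n. a n * t ^ n"] by simp
    then have "continuous (at x within S) (\<lambda>z. \<Sum>n. a n * (z - x) ^ n)"
      using continuous_at_imp_continuous_at_within by blast
    then show ?thesis
      by (rule continuous_transform_within[OF _ r(1) \<open>x \<in> S\<close>]) (use r(2) in \<open>auto simp: sums_iff dist_real_def\<close>)
  next
    case False
    then have "\<not> x islimpt S" using r(1) unfolding islimpt_approachable by (force simp: dist_real_def)
    then show ?thesis using trivial_limit_within continuous_trivial_limit by (metis continuous_within_eps_delta)
  qed
qed

text \<open>The holomorphic local inverse of the extension takes real values on the image of a real
  interval, because there it undoes \<open>f\<close>. The bound \<open>e\<close> lets the inverse be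
  kept inside a prescribed neighbourhood of \<open>x\<close>.\<close>

lemma real_analytic_at_local_inverse:
  assumes "real_analytic_at f x" "deriv f x \<noteq> 0" "e > 0"
  obtains g where "real_analytic_at g (f x)" "g (f x) = x"
    "\<forall>\<^sub>F w in nhds (f x). \<bar>g w - x\<bar> < e \<and> f (g w) = w" "deriv g (f x) = 1 / deriv f x"
proof -
  obtain r F where F: "r > 0" "F holomorphic_on ball (complex_of_real x) r"
    "\<And>y. \<bar>y - x\<bar> < r \<Longrightarrow> F (of_real y) = of_real (f y)"
    using real_analytic_atE[OF assms(1)] by metis
  have dF: "deriv F (of_real x) \<noteq> 0"
    using deriv_complex_extension(2)[OF F(2,3), of x] F(1) assms(2) by simp
  have hol: "F holomorphic_on ball (complex_of_real x) (min e r)"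
    using F(2) by (rule holomorphic_on_subset) auto
  obtain d where d: "d > 0" "ball (complex_of_real x) d \<subseteq> ball (complex_of_real x) (min e r)"
    "open (F ` ball (complex_of_real x) d)" "inj_on F (ball (complex_of_real x) d)"
    by (rule has_complex_derivative_locally_invertible[OF hol _ open_ball dF])
      (use F(1) assms(3) in auto)
  have "d \<le> min e r" using d(1,2) by (simp add: ball_subset_ball_iff)
  have holB: "F holomorphic_on ball (complex_of_real x) d"
    using hol d(2) holomorphic_on_subset by blast
  obtain G where G: "G holomorphic_on (F ` ball (complex_of_real x) d)"
    "\<And>z. z \<in> ball (complex_of_real x) d \<Longrightarrow> G (F z) = z"
    using holomorphic_has_inverse[OF holB open_ball d(4)] by metis
  define g where "g w = Re (G (of_real w))" for w
  have ball: "complex_of_real y \<in> ball (of_real x) d \<longleftrightarrow> \<bar>y - x\<bar> < d" for y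
    by (metis dist_commute dist_of_real dist_real_def mem_ball)
  have Ff: "F (of_real y) = of_real (f y)" if "y \<in> ball x d" for y
    using F(3)[of y] that \<open>d \<le> min e r\<close> by (simp add: dist_real_def abs_minus_commute)
  have Gf: "G (of_real (f y)) = of_real y" if "y \<in> ball x d" for y
    using G(2)[of "of_real y"] Ff[OF that] that ball[of y] by (simp add: dist_real_def abs_minus_commute)
  have inj: "inj_on f (ball x d)"
    by (rule inj_onI) (metis Gf of_real_eq_iff)
  have cont: "continuous_on (ball x d) f"
  proof (rule continuous_at_imp_continuous_on, rule)
    fix y assume "y \<in> ball x d"
    then have "\<bar>y - x\<bar> < r" using \<open>d \<le> min e r\<close> by (simp add: dist_real_def abs_minus_commute)
    then show "isCont f y" using DERIV_isCont deriv_complex_extension(1)[OF F(2,3)] by blast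
  qed
  \<comment> \<open>Needed to know that every real w near \<open>f x\<close> is of the form
    \<open>f y\<close>, so that the identities for \<open>G\<close> hold on a full
    neighbourhood.\<close>
  have "open (f ` ball x d)"
    using invariance_of_domain[OF cont open_ball inj] .
  then have ev: "\<forall>\<^sub>F w in nhds (f x). w \<in> f ` ball x d"
    by (rule eventually_nhds_in_open) (use d(1) in auto)
  have an: "real_analytic_at g (f x)"
  proof (rule real_analytic_atI[OF G(1) d(3)])
    show "complex_of_real (f x) \<in> F ` ball (complex_of_real x) d"
      using Ff[of x] d(1) by (metis centre_in_ball image_eqI)
    show "\<forall>\<^sub>F w in nhds (f x). G (of_real w) = of_real (g w)"
      using ev by eventually_elim (auto simp: g_def Gf)
  qed
  have gx: "g (f x) = x" unfolding g_def using Gf[of x] d(1) by simp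
  have ev2: "\<forall>\<^sub>F w in nhds (f x). \<bar>g w - x\<bar> < e \<and> f (g w) = w"
    using ev
  proof eventually_elim
    case (elim w)
    then obtain y where y: "y \<in> ball x d" "w = f y" by blast
    then have "g w = y" by (simp add: g_def Gf)
    then show ?case using y \<open>d \<le> min e r\<close> by (simp add: dist_real_def abs_minus_commute)
  qed
  have "(f has_real_derivative deriv f x) (at (g (f x)))"
    using real_analytic_at_has_deriv(1)[OF assms(1)] gx by simp
  from DERIV_chain2[OF this real_analytic_at_has_deriv(1)[OF an]]
  have "((\<lambda>w. f (g w)) has_real_derivative deriv f x * deriv g (f x)) (at (f x))" .
  moreover have "\<forall>\<^sub>F w in nhds (f x). f (g w) = w" using ev2 by eventually_elim simp
  ultimately have "((\<lambda>w. w) has_real_derivative deriv f x * deriv g (f x)) (at (f x))"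
    by (subst (asm) DERIV_cong_ev[OF refl _ refl])
  then have "deriv f x * deriv g (f x) = 1" using DERIV_ident DERIV_unique by blast
  then show ?thesis
    using that[OF an gx ev2] assms(2) by (simp add: field_simps)
qed

section \<open>Counting zeros with multiplicity\<close>

text \<open>A lower bound for the multiplicity. Unlike \<open>zero_multiplicity\<close> it is
  monotone in \<open>m\<close>, stable under sums and products, and meaningful for locally zero
  functions.\<close>

definition vanishes_to_order :: "nat \<Rightarrow> (real \<Rightarrow> real) \<Rightarrow> real \<Rightarrow> bool" where
  "vanishes_to_order m f x \<longleftrightarrow> (\<forall>i<m. (deriv ^^ i) f x = 0)"

lemma vanishes_to_order_0 [simp]: "vanishes_to_order 0 f x"
  by (simp add: vanishes_to_order_def)

lemma vanishes_to_order_Suc: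
  "vanishes_to_order (Suc m) f x \<longleftrightarrow> f x = 0 \<and> vanishes_to_order m (deriv f) x"
  by (simp add: vanishes_to_order_def All_less_Suc2 funpow_Suc_right del: funpow.simps)

lemma vanishes_to_order_mono: "vanishes_to_order m f x \<Longrightarrow> k \<le> m \<Longrightarrow> vanishes_to_order k f x"
  by (simp add: vanishes_to_order_def)

lemma vanishes_to_order_cong:
  assumes "\<forall>\<^sub>F y in nhds x. f y = g y"
  shows "vanishes_to_order m f x \<longleftrightarrow> vanishes_to_order m g x"
  unfolding vanishes_to_order_def using higher_deriv_cong_ev[OF assms refl] by simp

lemma deriv_add_nearby:
  assumes "real_analytic_at f x" "real_analytic_at g x"
  shows "\<forall>\<^sub>F y in nhds x. deriv (\<lambda>y. f y + g y) y = deriv f y + deriv g y"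
  using real_analytic_at_nearby[OF assms(1)] real_analytic_at_nearby[OF assms(2)]
  by eventually_elim (intro DERIV_imp_deriv DERIV_add real_analytic_at_has_deriv)

lemma deriv_mult_nearby:
  assumes "real_analytic_at f x" "real_analytic_at g x"
  shows "\<forall>\<^sub>F y in nhds x. deriv (\<lambda>y. f y * g y) y = deriv f y * g y + f y * deriv g y"
  using real_analytic_at_nearby[OF assms(1)] real_analytic_at_nearby[OF assms(2)]
proof eventually_elim
  case (elim y)
  show ?case
    using DERIV_mult[OF elim[THEN real_analytic_at_has_deriv(1)]] DERIV_imp_deriv
    by (metis (no_types, lifting) mult.commute)
qed

lemma vanishes_to_order_add:
  assumes "real_analytic_at f x" "real_analytic_at g x"
    and "vanishes_to_order m f x" "vanishes_to_order m g x"
  shows "vanishes_to_order m (\<lambda>y. f y + g y) x"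
  using assms
proof (induction m arbitrary: f g)
  case (Suc m)
  have "vanishes_to_order m (\<lambda>y. deriv f y + deriv g y) x"
    using Suc.prems by (intro Suc.IH real_analytic_at_has_deriv) (auto simp: vanishes_to_order_Suc)
  then show ?case
    using Suc.prems vanishes_to_order_cong[OF deriv_add_nearby[OF Suc.prems(1,2)]]
    by (simp add: vanishes_to_order_Suc)
qed simp

text \<open>Induction with the product rule: in f' g + f g' both f' and f vanish to order
  \<open>m\<close> when f vanishes to order m + 1. It permits multiplying and dividing by a
  nonvanishing function without loss of order.\<close>

lemma vanishes_to_order_mult:
  assumes "real_analytic_at f x" "real_analytic_at g x" "vanishes_to_order m f x"
  shows "vanishes_to_order m (\<lambda>y. f y * g y) x"
  using assms
proof (induction m arbitrary: f g)
  case (Suc m)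
  have "vanishes_to_order m f x"
    using Suc.prems(3) vanishes_to_order_mono by (meson le_SucI le_refl)
  then have "vanishes_to_order m (\<lambda>y. deriv f y * g y + f y * deriv g y) x"
    using Suc.prems
    by (intro vanishes_to_order_add real_analytic_at_mult Suc.IH real_analytic_at_has_deriv)
      (auto simp: vanishes_to_order_Suc)
  then show ?case
    using Suc.prems vanishes_to_order_cong[OF deriv_mult_nearby[OF Suc.prems(1,2)]]
    by (simp add: vanishes_to_order_Suc)
qed simp

text \<open>Each of the p zeros loses one unit of order under differentiation, and each of the p - 1
  gaps regains one by Rolle. The numbers \<open>m z\<close> need only be lower bounds for the
  orders.\<close>

lemma rolle_multiplicity:
  assumes "finite Z" "Z \<noteq> {}" "Z \<subseteq> V" "is_interval V"
    and "\<And>x. x \<in> V \<Longrightarrow> (f has_real_derivative deriv f x) (at x)"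
    and "\<And>z. z \<in> Z \<Longrightarrow> 0 < m z \<and> vanishes_to_order (m z) f z"
  obtains Z' m' where "finite Z'" "Z' \<subseteq> V" "\<And>z. z \<in> Z' \<Longrightarrow> vanishes_to_order (m' z) (deriv f) z"
    "sum m Z \<le> Suc (sum m' Z')"
proof -
  \<comment> \<open>Induction on the largest zero. The clause \<open>z \<le> Max Z\<close> separates
    the points already collected from the new zero \<open>b\<close> and from the Rolle point before
    it, so no order is counted twice.\<close>
  have "\<exists>Z' m'. finite Z' \<and> Z' \<subseteq> V \<and> (\<forall>z\<in>Z'. z \<le> Max Z \<and> vanishes_to_order (m' z) (deriv f) z) \<and>
    sum m Z \<le> Suc (sum m' Z')"
    using assms(1,2,3,6)
  proof (induction Z rule: finite_linorder_max_induct)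
    case (insert b A)
    have fb: "f b = 0" "vanishes_to_order (m b - 1) (deriv f) b" "m b > 0"
      using insert.prems(3)[of b] vanishes_to_order_Suc[of "m b - 1" f b] by auto
    show ?case
    proof (cases "A = {}")
      case True
      then show ?thesis using fb insert.prems(2)
        by (intro exI[of _ "{b}"] exI[of _ "\<lambda>z. m z - 1"]) auto
    next
      case False
      then obtain Z' m' where Z': "finite Z'" "Z' \<subseteq> V" "sum m A \<le> Suc (sum m' Z')"
        "\<And>z. z \<in> Z' \<Longrightarrow> z \<le> Max A \<and> vanishes_to_order (m' z) (deriv f) z"
        using insert.IH insert.prems(2,3) by (metis insert_iff insert_subset)
      define a where "a = Max A"
      have a: "a \<in> A" "a < b" using False insert.hyps by (auto simp: a_def)
      have "f a = 0" using insert.prems(3)[of a] a vanishes_to_order_Suc[of "m a - 1" f a] by auto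
      have sub: "z \<in> V" if "a \<le> z" "z \<le> b" for z
        using that a insert.prems(2) assms(4) mem_is_interval_1_I by (metis insert_subset subsetD)
      have "\<exists>\<xi>. a < \<xi> \<and> \<xi> < b \<and> DERIV f \<xi> :> 0"
      proof (rule Rolle[OF a(2)])
        show "continuous_on {a..b} f"
          using sub assms(5) by (intro continuous_at_imp_continuous_on) (meson DERIV_isCont atLeastAtMost_iff)
        show "f differentiable (at x)" if "a < x" "x < b" for x
          using sub[of x] that assms(5) real_differentiable_def by force
      qed (use fb \<open>f a = 0\<close> in auto)
      then obtain \<xi> where \<xi>: "a < \<xi>" "\<xi> < b" "deriv f \<xi> = 0" using DERIV_imp_deriv by blast
      have notin: "\<xi> \<notin> Z'" "b \<notin> Z'" "b \<noteq> \<xi>"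
        using Z'(4) \<xi> a unfolding a_def by (force, force, simp)
      define m'' where "m'' = (\<lambda>z. if z = b then m b - 1 else if z = \<xi> then 1 else m' z)"
      have "sum m'' Z' = sum m' Z'" using notin by (intro sum.cong) (auto simp: m''_def)
      then have sum: "sum m'' (insert b (insert \<xi> Z')) = m b - 1 + (1 + sum m' Z')"
        using notin Z'(1) by (simp add: m''_def)
      have "Max (insert b A) = b" using insert.hyps by (intro Max_eqI) (auto intro: less_imp_le)
      moreover have "z \<le> b" if "z \<in> Z'" for z using Z'(4)[OF that] a unfolding a_def by simp
      moreover have "b \<notin> A" using insert.hyps by auto
      moreover have "vanishes_to_order (m'' z) (deriv f) z" if "z \<in> insert b (insert \<xi> Z')" for z
        using that fb \<xi> Z'(4) by (auto simp: m''_def vanishes_to_order_Suc)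
      ultimately show ?thesis
        using sum Z' fb insert.hyps(1) \<xi> sub[of \<xi>] sub[of b] a
        by (intro exI[of _ "insert b (insert \<xi> Z')"] exI[of _ m'']) auto
    qed
  qed simp
  then show ?thesis using that by blast
qed

text \<open>The fourth hypothesis says that the Wronskians of the first k functions have no zeros,
  put without determinants. It passes to the derivatives of the quotients by \<open>u 0\<close>: a
  combination of these vanishing to order k at x integrates to a combination of the
  \<open>u j\<close> vanishing to order k + 1 there.\<close>

lemma zeros_less_if_nondegenerate:
  fixes u :: "nat \<Rightarrow> real \<Rightarrow> real"
  assumes "open V" "is_interval V"
    and "\<And>j x. j < N \<Longrightarrow> x \<in> V \<Longrightarrow> real_analytic_at (u j) x"
    and "\<And>k x c j. k \<le> N \<Longrightarrow> x \<in> V \<Longrightarrow> vanishes_to_order k (\<lambda>y. \<Sum>j<k. c j * u j y) x \<Longrightarrow> j < k \<Longrightarrow> c j = 0"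
    and "j < N" "c j \<noteq> 0" "finite Z" "Z \<subseteq> V"
    and "\<And>z. z \<in> Z \<Longrightarrow> vanishes_to_order (m z) (\<lambda>y. \<Sum>j<N. c j * u j y) z"
  shows "sum m Z < N"
  using assms(3-)
proof (induction N arbitrary: u c Z m j)
  case (Suc N)
  note an = Suc.prems(1) and nondeg = Suc.prems(2)
  \<comment> \<open>Points with m z = 0 add nothing to the sum, but Rolle may only use genuine
    zeros.\<close>
  define Z1 where "Z1 = {z\<in>Z. 0 < m z}"
  have Z1: "finite Z1" "Z1 \<subseteq> V" "sum m Z = sum m Z1"
    using Suc.prems(5,6) by (auto simp: Z1_def intro!: sum.mono_neutral_right)
  define F where "F = (\<lambda>y. \<Sum>j<Suc N. c j * u j y)"
  have vanF: "vanishes_to_order (m z) F z" if "z \<in> Z1" for z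
    using Suc.prems(7) that unfolding F_def Z1_def by blast
  have anF: "real_analytic_at F x" if "x \<in> V" for x
    unfolding F_def using an that by (intro real_analytic_at_sum) auto
  \<comment> \<open>The case k = 1 of nondegeneracy: the first function has no zeros, so division by
    it is allowed.\<close>
  have u0: "u 0 x \<noteq> 0" if "x \<in> V" for x
    using nondeg[of 1 x "\<lambda>_. 1" 0] that by (auto simp: vanishes_to_order_def)
  have near: "\<forall>\<^sub>F y in nhds x. y \<in> V" if "x \<in> V" for x
    using assms(1) that eventually_nhds_in_open by blast
  define w where "w = (\<lambda>j. deriv (\<lambda>y. u (Suc j) y / u 0 y))"
  have anq: "real_analytic_at (\<lambda>y. u (Suc j) y / u 0 y) x" if "j < N" "x \<in> V" for j x
    using that u0 an by (intro real_analytic_at_divide) auto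
  have deriv_comb: "deriv (\<lambda>y. (\<Sum>j<k. d j * (u (Suc j) y / u 0 y)) + e) x = (\<Sum>j<k. d j * w j x)"
    if "k \<le> N" "x \<in> V" for k d e x
  proof -
    have "((\<lambda>y. (\<Sum>j<k. d j * (u (Suc j) y / u 0 y)) + e) has_real_derivative (\<Sum>j<k. d j * w j x) + 0) (at x)"
      using that unfolding w_def
      by (intro DERIV_add DERIV_const DERIV_sum DERIV_cmult real_analytic_at_has_deriv(1) anq) auto
    then show ?thesis using DERIV_imp_deriv by auto
  qed
  show ?case
  proof (cases "Z1 = {}")
    case False
    show ?thesis
    proof (cases "\<exists>j<N. c (Suc j) \<noteq> 0")
      case True
      then obtain j where j: "j < N" "c (Suc j) \<noteq> 0" by blast
      define G where "G = (\<lambda>y. F y * (1 / u 0 y))"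
      have anG: "real_analytic_at G x" "vanishes_to_order k F x \<Longrightarrow> vanishes_to_order k G x"
        if "x \<in> V" for x k
        unfolding G_def using that anF u0 an
        by (intro vanishes_to_order_mult real_analytic_at_mult real_analytic_at_divide; simp)+
      obtain Z' m' where Z': "finite Z'" "Z' \<subseteq> V" "\<And>z. z \<in> Z' \<Longrightarrow> vanishes_to_order (m' z) (deriv G) z"
        "sum m Z1 \<le> Suc (sum m' Z')"
      proof (rule rolle_multiplicity[OF Z1(1) False Z1(2) assms(2)])
        show "(G has_real_derivative deriv G x) (at x)" if "x \<in> V" for x
          using real_analytic_at_has_deriv(1) anG(1)[OF that] by blast
        show "0 < m z \<and> vanishes_to_order (m z) G z" if "z \<in> Z1" for z
          using that anG(2) vanF Z1(2) unfolding Z1_def by blast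
      qed blast
      have G_eq: "G y = (\<Sum>j<N. c (Suc j) * (u (Suc j) y / u 0 y)) + c 0" if "y \<in> V" for y
        unfolding G_def F_def sum.lessThan_Suc_shift using u0[OF that]
        by (simp add: add_divide_distrib sum_divide_distrib)
      have dG: "deriv G y = (\<Sum>j<N. c (Suc j) * w j y)" if "y \<in> V" for y
      proof -
        have "\<forall>\<^sub>F x in nhds y. G x = (\<Sum>j<N. c (Suc j) * (u (Suc j) x / u 0 x)) + c 0"
          using near[OF that] by eventually_elim (rule G_eq)
        from deriv_cong_ev[OF this refl] show ?thesis using deriv_comb[OF le_refl that] by simp
      qed
      have "sum m' Z' < N"
      proof (rule Suc.IH[of w j "\<lambda>j. c (Suc j)" Z' m'])
        show "real_analytic_at (w j) x" if "j < N" "x \<in> V" for j x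
          unfolding w_def using anq[OF that] by (rule real_analytic_at_has_deriv(2))
        show "vanishes_to_order (m' z) (\<lambda>y. \<Sum>j<N. c (Suc j) * w j y) z" if "z \<in> Z'" for z
        proof -
          have zV: "z \<in> V" using that Z'(2) by blast
          have "\<forall>\<^sub>F y in nhds z. deriv G y = (\<Sum>j<N. c (Suc j) * w j y)"
            using near[OF zV] by eventually_elim (rule dG)
          from vanishes_to_order_cong[OF this] show ?thesis using Z'(3)[OF that] by simp
        qed
        fix k x d i
        assume k: "k \<le> N" and x: "x \<in> V" and van: "vanishes_to_order k (\<lambda>y. \<Sum>j<k. d j * w j y) x"
          and i: "i < k"
        \<comment> \<open>The constant of integration: it makes \<open>H\<close> vanish at
          \<open>x\<close>, which raises the order of its derivative by one. After multiplication by
          \<open>u 0\<close> it becomes the coefficient of \<open>u 0\<close>.\<close>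
        define e where "e = - (\<Sum>j<k. d j * (u (Suc j) x / u 0 x))"
        define H where "H = (\<lambda>y. (\<Sum>j<k. d j * (u (Suc j) y / u 0 y)) + e)"
        define c' where "c' j = (case j of 0 \<Rightarrow> e | Suc j \<Rightarrow> d j)" for j
        have "\<forall>\<^sub>F y in nhds x. deriv H y = (\<Sum>j<k. d j * w j y)"
          using near[OF x] unfolding H_def by eventually_elim (rule deriv_comb[OF k])
        from vanishes_to_order_cong[OF this] have "vanishes_to_order (Suc k) H x"
          using van by (simp add: vanishes_to_order_Suc) (simp add: H_def e_def)
        moreover have "real_analytic_at H x"
          unfolding H_def using anq x k by (intro real_analytic_at_add real_analytic_at_sum) auto
        ultimately have van': "vanishes_to_order (Suc k) (\<lambda>y. H y * u 0 y) x"
          using an x by (intro vanishes_to_order_mult) auto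
        have ev: "\<forall>\<^sub>F y in nhds x. H y * u 0 y = (\<Sum>j<Suc k. c' j * u j y)"
          using near[OF x]
        proof eventually_elim
          case (elim y)
          show ?case unfolding H_def sum.lessThan_Suc_shift c'_def using u0[OF elim]
            by (simp add: sum_distrib_right distrib_right)
        qed
        have "vanishes_to_order (Suc k) (\<lambda>y. \<Sum>j<Suc k. c' j * u j y) x"
          using van' vanishes_to_order_cong[OF ev] by blast
        from nondeg[OF _ x this, of "Suc i"] show "d i = 0"
          using k i by (simp add: c'_def)
      qed (use j Z' in auto)
      then show ?thesis using Z' Z1 by linarith
    next
      \<comment> \<open>Differentiation would kill this combination: only \<open>c 0 * u 0\<close>
        is left. It has no zeros at all, against \<open>Z1 \<noteq> {}\<close>.\<close>
      case False
      obtain z where z: "z \<in> Z1" using \<open>Z1 \<noteq> {}\<close> by blast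
      have "F z = 0" using vanF[OF z] z unfolding Z1_def vanishes_to_order_def by force
      moreover have "F z = c 0 * u 0 z"
        unfolding F_def sum.lessThan_Suc_shift using False by simp
      moreover have "c 0 \<noteq> 0" using False Suc.prems(3,4) by (cases j) auto
      ultimately show ?thesis using u0 z Z1 by force
    qed
  qed (use Z1 in simp)
qed simp

lemma ECT_systemI:
  assumes V: "open V" "is_interval V"
    and an: "\<And>j x. j < N \<Longrightarrow> x \<in> V \<Longrightarrow> real_analytic_at (L j) x"
    and nondeg: "\<And>k x c j. k \<le> N \<Longrightarrow> x \<in> V \<Longrightarrow> vanishes_to_order k (\<lambda>y. \<Sum>j<k. c j * L j y) x
      \<Longrightarrow> j < k \<Longrightarrow> c j = 0"
  shows "ECT_system N L V"
  unfolding ECT_system_def Let_def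
proof (intro conjI allI impI ballI)
  show "real_analytic_on (L j) V" if "j < N" for j
    using an that by (intro real_analytic_onI)
  fix k c assume k: "k \<in> {1..N}" and c: "\<exists>j<k. c j \<noteq> (0::real)"
  then obtain j where j: "j < k" "c j \<noteq> 0" by blast
  define f where "f = (\<lambda>x. \<Sum>j<k. c j * L j x)"
  have count: "sum m Z < k" if "finite Z" "Z \<subseteq> V" "\<And>z. z \<in> Z \<Longrightarrow> vanishes_to_order (m z) f z" for Z m
  proof (rule zeros_less_if_nondegenerate[OF V _ _ j that[unfolded f_def]])
    show "real_analytic_at (L i) x" if "i < k" "x \<in> V" for i x
      using an k that by simp
    show "d i = 0" if "q \<le> k" "x \<in> V" "vanishes_to_order q (\<lambda>y. \<Sum>j<q. d j * L j y) x" "i < q" for q x d i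
      using nondeg[OF _ that(2,3,4)] k that(1) by simp
  qed
  \<comment> \<open>Among infinitely many zeros one could pick k of them, each of order at least 1,
    against the count.\<close>
  show fin: "finite {x \<in> V. (\<Sum>j<k. c j * L j x) = 0}"
  proof (rule ccontr)
    assume "infinite {x \<in> V. (\<Sum>j<k. c j * L j x) = 0}"
    then obtain Z where Z: "Z \<subseteq> {x \<in> V. f x = 0}" "finite Z" "card Z = k"
      using infinite_arbitrarily_large f_def by blast
    have "sum (\<lambda>_. 1) Z < k"
      by (rule count) (use Z in \<open>auto simp: vanishes_to_order_def\<close>)
    then show False using Z by simp
  qed
  \<comment> \<open>All derivatives below a \<open>LEAST\<close> index vanish whatever that index
    is, so \<open>zero_multiplicity\<close> is an admissible order in \<open>count\<close>.\<close>
  have "(\<Sum>x\<in>{x \<in> V. f x = 0}. zero_multiplicity f x) < k"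
    by (intro count) (use fin in \<open>simp add: f_def\<close>, auto simp: vanishes_to_order_def zero_multiplicity_def dest: not_less_Least)
  then show "(\<Sum>x\<in>{x \<in> V. (\<Sum>j<k. c j * L j x) = 0}. zero_multiplicity (\<lambda>x. \<Sum>j<k. c j * L j x) x) \<le> k - 1"
    unfolding f_def by linarith
qed

section \<open>Fractional integrals\<close>

text \<open>Termwise integration from summability of the L1 norms, with functions extended by 0
  outside \<open>S\<close>. The number \<open>t\<close> is fixed; keeping it apart displays the
  result as a power series.\<close>

lemma sums_integral_power_series:
  fixes k :: "nat \<Rightarrow> real \<Rightarrow> real"
  assumes int: "\<And>m. k m absolutely_integrable_on S"
    and abs: "\<And>v. v \<in> S \<Longrightarrow> summable (\<lambda>m. \<bar>k m v * t ^ m\<bar>)"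
    and K: "\<And>v. v \<in> S \<Longrightarrow> (\<lambda>m. k m v * t ^ m) sums K v"
    and sm: "summable (\<lambda>m. integral S (\<lambda>v. \<bar>k m v\<bar>) * \<bar>t\<bar> ^ m)"
  shows "K absolutely_integrable_on S" "(\<lambda>m. integral S (k m) * t ^ m) sums integral S K"
proof -
  define f where "f m v = indicator S v *\<^sub>R (k m v * t ^ m)" for m v
  have set_int: "(\<lambda>v. k m v * t ^ m) absolutely_integrable_on S" for m
    using int by (intro set_integrable_mult_left)
  have int': "integrable lebesgue (f m)" for m
    using set_int unfolding f_def set_integrable_def .
  have LINT: "integral\<^sup>L lebesgue (f m) = integral S (k m) * t ^ m" for m
  proof -
    have "integral\<^sup>L lebesgue (f m) = integral S (\<lambda>v. k m v * t ^ m)"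
      using set_lebesgue_integral_eq_integral(2)[OF set_int[of m]]
      unfolding f_def set_lebesgue_integral_def .
    then show ?thesis by simp
  qed
  have norm: "(\<integral>v. norm (f m v) \<partial>lebesgue) = integral S (\<lambda>v. \<bar>k m v\<bar>) * \<bar>t\<bar> ^ m" for m
  proof -
    have "(\<lambda>v. \<bar>k m v * t ^ m\<bar>) absolutely_integrable_on S"
      using absolutely_integrable_norm[OF set_int[of m]] by (simp add: o_def)
    from set_lebesgue_integral_eq_integral(2)[OF this]
    have "(\<integral>v. indicator S v *\<^sub>R \<bar>k m v * t ^ m\<bar> \<partial>lebesgue) = integral S (\<lambda>v. \<bar>k m v * t ^ m\<bar>)"
      unfolding set_lebesgue_integral_def .
    moreover have "indicator S v *\<^sub>R \<bar>k m v * t ^ m\<bar> = norm (f m v)" for v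
      by (simp add: f_def indicator_def)
    ultimately show ?thesis by (simp add: abs_mult power_abs)
  qed
  have "summable (\<lambda>m. norm (f m v))" for v
    using abs[of v] by (cases "v \<in> S") (simp_all add: f_def)
  note L = int' AE_I2[OF this] sm[folded norm]
  have sum_eq: "(\<Sum>m. f m v) = indicator S v *\<^sub>R K v" for v
    using K[of v] by (cases "v \<in> S") (simp_all add: f_def sums_iff)
  show K': "K absolutely_integrable_on S"
    using integrable_suminf[of lebesgue f, OF L] unfolding sum_eq set_integrable_def .
  have "(\<lambda>m. integral\<^sup>L lebesgue (f m)) sums integral\<^sup>L lebesgue (\<lambda>v. indicator S v *\<^sub>R K v)"
    using sums_integral[of lebesgue f, OF L] unfolding sum_eq .
  then show "(\<lambda>m. integral S (k m) * t ^ m) sums integral S K"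
    using set_lebesgue_integral_eq_integral(2)[OF K'] unfolding LINT set_lebesgue_integral_def by simp
qed

lemma absolutely_integrable_mult_continuous:
  fixes g \<phi> :: "real \<Rightarrow> real"
  assumes "g absolutely_integrable_on {a..b}" "continuous_on {a..b} \<phi>"
  shows "(\<lambda>v. g v * \<phi> v) absolutely_integrable_on {a..b}"
proof -
  have "(\<lambda>v. \<phi> v * g v) absolutely_integrable_on {a..b}"
    by (intro absolutely_integrable_bounded_measurable_product_real continuous_imp_measurable_on_sets_lebesgue
        assms compact_imp_bounded compact_continuous_image) auto
  then show ?thesis by (simp add: mult.commute)
qed

text \<open>The Riemann-Liouville integral of order \<beta> + 1, without its factor 1 / Gamma
  (\<beta> + 1).\<close>

definition fractional_integral :: "real \<Rightarrow> (real \<Rightarrow> real) \<Rightarrow> real \<Rightarrow> real" where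
  "fractional_integral \<beta> g h = integral {0..h} (\<lambda>v. g v * (h - v) powr \<beta>)"

text \<open>For v <= b the distance h - v is at least h - b > |t|, so the kernel at h + t has a
  binomial expansion in t that converges uniformly in v. Of \<open>g\<close> only integrability is
  used, which admits a singularity at 0.\<close>

lemma fractional_integral_head:
  fixes g :: "real \<Rightarrow> real"
  assumes g: "g absolutely_integrable_on {0..b}" and b: "0 < b" "b < h" and t: "\<bar>t\<bar> < h - b"
  shows "(\<lambda>v. g v * (h + t - v) powr \<beta>) absolutely_integrable_on {0..b}"
    "(\<lambda>m. ((\<beta> gchoose m) * integral {0..b} (\<lambda>v. g v * (h - v) powr (\<beta> - m))) * t ^ m) sums
      integral {0..b} (\<lambda>v. g v * (h + t - v) powr \<beta>)"
proof -
  define k where "k m v = (\<beta> gchoose m) * (g v * (h - v) powr (\<beta> - m))" for m :: nat and v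
  have pos: "0 < h - v" "h - b \<le> h - v" "h - v \<le> h" if "v \<in> {0..b}" for v using that b by auto
  have int: "k m absolutely_integrable_on {0..b}" for m
    unfolding k_def
    by (intro set_integrable_mult_right absolutely_integrable_mult_continuous g
        continuous_on_powr' continuous_intros) (use b in auto)
  have binom: "(\<lambda>m. k m v * t ^ m) sums (g v * (h + t - v) powr \<beta>)" if "v \<in> {0..b}" for v
  proof -
    have "(\<lambda>m. (\<beta> gchoose m) * (h - v) powr (\<beta> - m) * t ^ m) sums ((h - v) + t) powr \<beta>"
      by (rule gen_binomial_real'') (use pos[OF that] t in auto)
    from sums_mult[OF this, of "g v"] show ?thesis by (simp add: k_def mult_ac algebra_simps)
  qed
  \<comment> \<open>The kernel is monotone in v in a direction that depends on the sign of \<beta>;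
    the larger of two end values covers both cases.\<close>
  define C where "C = max (h powr \<beta>) ((h - b) powr \<beta>)"
  have C: "(h - v) powr \<beta> \<le> C" if "v \<in> {0..b}" for v
  proof (cases "\<beta> \<ge> 0")
    case True
    then have "(h - v) powr \<beta> \<le> h powr \<beta>" using pos[OF that] by (intro powr_mono2) auto
    then show ?thesis by (simp add: C_def)
  next
    case False
    then have "(h - v) powr \<beta> \<le> (h - b) powr \<beta>" using pos[OF that] b by (intro powr_mono2') auto
    then show ?thesis by (simp add: C_def)
  qed
  \<comment> \<open>The term of index m is majorised by a multiple of |\<beta> gchoose m| * q ^ m,
    and the binomial series has radius of convergence at least 1.\<close>
  define q where "q = \<bar>t\<bar> / (h - b)"
  have q: "0 \<le> q" "q < 1" using t b by (auto simp: q_def)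
  have smq: "summable (\<lambda>m. \<bar>\<beta> gchoose m\<bar> * q ^ m)"
  proof -
    have "ereal (norm q) < conv_radius (\<lambda>m. \<beta> gchoose m)"
      using q by (auto simp: conv_radius_gchoose)
    from abs_summable_in_conv_radius[OF this] show ?thesis using q by (simp add: abs_mult)
  qed
  have kb: "\<bar>k m v\<bar> \<le> \<bar>\<beta> gchoose m\<bar> * (\<bar>g v\<bar> * (C / (h - b) ^ m))" if v: "v \<in> {0..b}" for m v
  proof -
    have "(h - v) powr (\<beta> - m) = (h - v) powr \<beta> / (h - v) ^ m"
      using pos[OF v] by (simp add: powr_diff powr_realpow)
    also have "\<dots> \<le> C / (h - b) ^ m"
      using pos[OF v] b C[OF v] by (intro frac_le power_mono) (auto intro: order_trans[OF powr_ge_zero])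
    finally show ?thesis
      unfolding k_def abs_mult by (intro mult_left_mono) auto
  qed
  have gabs: "(\<lambda>v. \<bar>g v\<bar>) absolutely_integrable_on {0..b}"
    using absolutely_integrable_norm[OF g] by (simp add: o_def)
  have kt: "\<bar>k m v * t ^ m\<bar> \<le> (\<bar>g v\<bar> * C) * (\<bar>\<beta> gchoose m\<bar> * q ^ m)" if v: "v \<in> {0..b}" for m v
  proof -
    have "\<bar>k m v * t ^ m\<bar> \<le> \<bar>\<beta> gchoose m\<bar> * (\<bar>g v\<bar> * (C / (h - b) ^ m)) * \<bar>t\<bar> ^ m"
      unfolding abs_mult power_abs by (intro mult_right_mono kb v) auto
    also have "\<dots> = (\<bar>g v\<bar> * C) * (\<bar>\<beta> gchoose m\<bar> * q ^ m)"
      by (simp add: q_def power_divide)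
    finally show ?thesis .
  qed
  have abs: "summable (\<lambda>m. \<bar>k m v * t ^ m\<bar>)" if v: "v \<in> {0..b}" for v
    by (rule summable_comparison_test'[OF summable_mult[OF smq, of "\<bar>g v\<bar> * C"], of 0])
      (use kt[OF v] in simp)
  have sm: "summable (\<lambda>m. integral {0..b} (\<lambda>v. \<bar>k m v\<bar>) * \<bar>t\<bar> ^ m)"
  proof (rule summable_comparison_test'[OF summable_mult[OF smq, of "integral {0..b} (\<lambda>v. \<bar>g v\<bar>) * C"], of 0])
    fix m :: nat
    have kabs: "(\<lambda>v. \<bar>k m v\<bar>) integrable_on {0..b}"
      using absolutely_integrable_norm[OF int[of m]]
      by (simp add: o_def absolutely_integrable_on_def)
    have "integral {0..b} (\<lambda>v. \<bar>k m v\<bar>) \<le> integral {0..b} (\<lambda>v. \<bar>\<beta> gchoose m\<bar> * (\<bar>g v\<bar> * (C / (h - b) ^ m)))"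
      by (intro integral_le kabs kb integrable_on_mult_right integrable_on_mult_left)
        (use gabs in \<open>auto simp: absolutely_integrable_on_def\<close>)
    also have "\<dots> = \<bar>\<beta> gchoose m\<bar> * (integral {0..b} (\<lambda>v. \<bar>g v\<bar>) * (C / (h - b) ^ m))"
      by simp
    finally have "integral {0..b} (\<lambda>v. \<bar>k m v\<bar>) * \<bar>t\<bar> ^ m
      \<le> \<bar>\<beta> gchoose m\<bar> * (integral {0..b} (\<lambda>v. \<bar>g v\<bar>) * (C / (h - b) ^ m)) * \<bar>t\<bar> ^ m"
      by (intro mult_right_mono) auto
    also have "\<dots> = integral {0..b} (\<lambda>v. \<bar>g v\<bar>) * C * (\<bar>\<beta> gchoose m\<bar> * q ^ m)"
      by (simp add: q_def power_divide)
    finally show "norm (integral {0..b} (\<lambda>v. \<bar>k m v\<bar>) * \<bar>t\<bar> ^ m)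
        \<le> integral {0..b} (\<lambda>v. \<bar>g v\<bar>) * C * (\<bar>\<beta> gchoose m\<bar> * q ^ m)"
      using integral_nonneg[OF kabs] by (simp add: abs_mult)
  qed
  show "(\<lambda>v. g v * (h + t - v) powr \<beta>) absolutely_integrable_on {0..b}"
    by (rule sums_integral_power_series(1)[OF int abs binom sm])
  have "(\<lambda>m. integral {0..b} (k m) * t ^ m) sums integral {0..b} (\<lambda>v. g v * (h + t - v) powr \<beta>)"
    by (rule sums_integral_power_series(2)[OF int abs binom sm])
  then show "(\<lambda>m. ((\<beta> gchoose m) * integral {0..b} (\<lambda>v. g v * (h - v) powr (\<beta> - m))) * t ^ m) sums
      integral {0..b} (\<lambda>v. g v * (h + t - v) powr \<beta>)"
    unfolding k_def by simp
qed

text \<open>The substitution v = b + w t turns this into Euler's Beta integral. Scaling the monomial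
  by w keeps it between 0 and 1.\<close>

lemma integral_Beta_affine:
  assumes "w > 0" "\<beta> > -1"
  shows "(\<lambda>v. ((v - b) / w) ^ m * (b + w - v) powr \<beta>) absolutely_integrable_on {b..b + w}"
    "integral {b..b + w} (\<lambda>v. ((v - b) / w) ^ m * (b + w - v) powr \<beta>) = w powr (\<beta> + 1) * Beta (real m + 1) (\<beta> + 1)"
proof -
  let ?f = "\<lambda>v. ((v - b) / w) ^ m * (b + w - v) powr \<beta>"
  have "((\<lambda>t. t powr real m * (1 - t) powr \<beta>) has_integral Beta (real m + 1) (\<beta> + 1)) {0..1}"
    using has_integral_Beta_real[of "real m + 1" "\<beta> + 1"] assms by simp
  \<comment> \<open>The point t = 0 must go before \<open>powr\<close> becomes a power:
    \<open>0 powr 0\<close> is 0, while \<open>0 ^ 0\<close> is 1.\<close>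
  then have "((\<lambda>t. t powr real m * (1 - t) powr \<beta>) has_integral Beta (real m + 1) (\<beta> + 1)) {0<..<1}"
    by (simp add: has_integral_Icc_iff_Ioo)
  from has_integral_mult_right[OF this, of "w powr (\<beta> + 1)"]
  have *: "((\<lambda>t. \<bar>w\<bar> * ?f (b + w * t)) has_integral (w powr (\<beta> + 1) * Beta (real m + 1) (\<beta> + 1))) {0<..<1}"
  proof (rule has_integral_eq[rotated])
    fix t :: real assume t: "t \<in> {0<..<1}"
    have "(b + w - (b + w * t)) powr \<beta> = w powr \<beta> * (1 - t) powr \<beta>"
      using t assms by (simp flip: powr_mult add: algebra_simps)
    then show "w powr (\<beta> + 1) * (t powr real m * (1 - t) powr \<beta>) = \<bar>w\<bar> * ?f (b + w * t)"
      using t assms by (simp add: powr_realpow powr_add)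
  qed
  then have "(\<lambda>t. \<bar>w\<bar> * ?f (b + w * t)) absolutely_integrable_on {0<..<1}"
    using assms by (intro nonnegative_absolutely_integrable_1) (auto simp: integrable_on_def)
  moreover have "integral {0<..<1} (\<lambda>t. \<bar>w\<bar> * ?f (b + w * t)) = w powr (\<beta> + 1) * Beta (real m + 1) (\<beta> + 1)"
    using * by (rule integral_unique)
  ultimately have "?f absolutely_integrable_on ((\<lambda>t. b + w * t) ` {0<..<1}) \<and>
    integral ((\<lambda>t. b + w * t) ` {0<..<1}) ?f = w powr (\<beta> + 1) * Beta (real m + 1) (\<beta> + 1)"
    by (subst has_absolute_integral_change_of_variables_1'[where g' = "\<lambda>_. w", symmetric])
      (use assms in \<open>auto intro!: derivative_eq_intros inj_onI\<close>)
  moreover have "(\<lambda>t. b + w * t) ` {0<..<1} = {b<..<b + w}"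
  proof (intro equalityI subsetI)
    fix x assume "x \<in> {b<..<b + w}"
    then show "x \<in> (\<lambda>t. b + w * t) ` {0<..<1}"
      using assms by (intro image_eqI[of _ _ "(x - b) / w"]) (auto simp: field_simps)
  qed (use assms in auto)
  ultimately show "?f absolutely_integrable_on {b..b + w}"
    "integral {b..b + w} ?f = w powr (\<beta> + 1) * Beta (real m + 1) (\<beta> + 1)"
    by (simp_all add: absolutely_integrable_on_Icc_iff_Ioo integral_open_interval_real)
qed

text \<open>Here the kernel is singular at the upper end, but \<open>g\<close> has a power series at
  \<open>b\<close> that reaches beyond b + w. Integrating its terms shows that the tail is w powr
  (\<beta> + 1) times a power series in w.\<close>

lemma fractional_integral_tail:
  assumes a: "\<And>t. \<bar>t\<bar> < r \<Longrightarrow> (\<lambda>m. a m * t ^ m) sums g (b + t)"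
    and w: "0 < w" "w < r" and \<beta>: "\<beta> > -1"
  shows "(\<lambda>v. g v * (b + w - v) powr \<beta>) absolutely_integrable_on {b..b + w}"
    "(\<lambda>m. a m * Beta (real m + 1) (\<beta> + 1) * w ^ m) sums
      (w powr - (\<beta> + 1) * integral {b..b + w} (\<lambda>v. g v * (b + w - v) powr \<beta>))"
proof -
  define k where "k m v = a m * (((v - b) / w) ^ m * (b + w - v) powr \<beta>)" for m v
  note B = integral_Beta_affine[OF w(1) \<beta>]
  have int: "k m absolutely_integrable_on {b..b+w}" for m
    unfolding k_def using B(1) by (intro set_integrable_mult_right)
  \<comment> \<open>Any point strictly between w and r would do: convergence there gives absolute
    convergence at w.\<close>
  have "(\<lambda>m. a m * ((w + r) / 2) ^ m) sums g (b + (w + r) / 2)"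
    using w by (intro a) auto
  then have sma: "summable (\<lambda>m. \<bar>a m * w ^ m\<bar>)"
    using powser_insidea[of a "(w + r) / 2" w] w by (auto simp: sums_iff)
  have K: "(\<lambda>m. k m v * w ^ m) sums (g v * (b + w - v) powr \<beta>)" if "v \<in> {b..b+w}" for v
  proof -
    have "(\<lambda>m. a m * (v - b) ^ m) sums g (b + (v - b))"
      using w that by (intro a) auto
    from sums_mult2[OF this, of "(b + w - v) powr \<beta>"] show ?thesis
      using w by (simp add: k_def power_divide mult_ac)
  qed
  have abs: "summable (\<lambda>m. \<bar>k m v * w ^ m\<bar>)" if v: "v \<in> {b..b+w}" for v
  proof (rule summable_comparison_test'[OF summable_mult[OF sma, of "(b + w - v) powr \<beta>"], of 0])
    fix m :: nat
    have "((v - b) / w) ^ m \<le> 1" using v w by (intro power_le_one) auto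
    then have "\<bar>((v - b) / w) ^ m\<bar> * ((b + w - v) powr \<beta> * \<bar>a m * w ^ m\<bar>) \<le> 1 * ((b + w - v) powr \<beta> * \<bar>a m * w ^ m\<bar>)"
      using v w by (intro mult_right_mono) auto
    then show "norm \<bar>k m v * w ^ m\<bar> \<le> (b + w - v) powr \<beta> * \<bar>a m * w ^ m\<bar>"
      by (simp add: k_def abs_mult mult_ac)
  qed
  have sm: "summable (\<lambda>m. integral {b..b+w} (\<lambda>v. \<bar>k m v\<bar>) * \<bar>w\<bar> ^ m)"
  proof (rule summable_comparison_test'[OF summable_mult[OF sma, of "w powr (\<beta> + 1) * Beta 1 (\<beta> + 1)"], of 0])
    fix m :: nat
    have "integral {b..b+w} (\<lambda>v. \<bar>k m v\<bar>) = integral {b..b+w} (\<lambda>v. \<bar>a m\<bar> * (((v - b) / w) ^ m * (b + w - v) powr \<beta>))"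
      using w by (intro integral_cong) (simp add: k_def abs_mult)
    also have "\<dots> = \<bar>a m\<bar> * (w powr (\<beta> + 1) * Beta (real m + 1) (\<beta> + 1))"
      using B(2) by simp
    finally have eq: "integral {b..b+w} (\<lambda>v. \<bar>k m v\<bar>) * \<bar>w\<bar> ^ m =
      w powr (\<beta> + 1) * Beta (real m + 1) (\<beta> + 1) * \<bar>a m * w ^ m\<bar>"
      by (simp add: abs_mult power_abs)
    have B0: "0 \<le> Beta (real m + 1) (\<beta> + 1)"
      using \<beta> by (simp add: Beta_def Gamma_real_pos less_imp_le)
    \<comment> \<open>Beta decreases in its first argument, so its value at m = 0 dominates all
      terms.\<close>
    have "Beta (real m + 1) (\<beta> + 1) \<le> Beta 1 (\<beta> + 1)"
      using \<beta> by (intro Beta_real_mono) auto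
    then have "w powr (\<beta> + 1) * Beta (real m + 1) (\<beta> + 1) * \<bar>a m * w ^ m\<bar>
        \<le> w powr (\<beta> + 1) * Beta 1 (\<beta> + 1) * \<bar>a m * w ^ m\<bar>"
      by (intro mult_right_mono mult_left_mono) auto
    then show "norm (integral {b..b+w} (\<lambda>v. \<bar>k m v\<bar>) * \<bar>w\<bar> ^ m)
        \<le> w powr (\<beta> + 1) * Beta 1 (\<beta> + 1) * \<bar>a m * w ^ m\<bar>"
      unfolding eq using B0 by (simp add: abs_mult)
  qed
  show "(\<lambda>v. g v * (b + w - v) powr \<beta>) absolutely_integrable_on {b..b + w}"
    by (rule sums_integral_power_series(1)[OF int abs K sm])
  have "(\<lambda>m. integral {b..b+w} (k m) * w ^ m) sums integral {b..b+w} (\<lambda>v. g v * (b + w - v) powr \<beta>)"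
    by (rule sums_integral_power_series(2)[OF int abs K sm])
  from sums_mult[OF this, of "w powr - (\<beta> + 1)"]
  show "(\<lambda>m. a m * Beta (real m + 1) (\<beta> + 1) * w ^ m) sums
      (w powr - (\<beta> + 1) * integral {b..b + w} (\<lambda>v. g v * (b + w - v) powr \<beta>))"
  proof (rule back_subst[of "\<lambda>f. f sums _"], intro ext)
    fix m
    have I: "integral {b..b+w} (k m) = a m * (w powr (\<beta> + 1) * Beta (real m + 1) (\<beta> + 1))"
      unfolding k_def using B(2) by simp
    have "w powr - (\<beta> + 1) * (integral {b..b + w} (k m) * w ^ m) =
        (w powr - (\<beta> + 1) * w powr (\<beta> + 1)) * (a m * Beta (real m + 1) (\<beta> + 1) * w ^ m)"
      unfolding I by (simp only: mult_ac)
    also have "w powr - (\<beta> + 1) * w powr (\<beta> + 1) = 1"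
      using w by (simp flip: powr_add)
    finally show "w powr - (\<beta> + 1) * (integral {b..b + w} (k m) * w ^ m) = a m * Beta (real m + 1) (\<beta> + 1) * w ^ m"
      by simp
  qed
qed

text \<open>For y near h the integral over (0, y) is \<open>A\<close>, a power series in y - h, plus
  (y - b) powr (\<beta> + 1) times \<open>P\<close>, a power series in y - b. All three ingredients
  are analytic at h because b < h is fixed. The derivative is computed on this form, so that the
  kernel is never differentiated at its singular end.\<close>

lemma
  fixes g :: "real \<Rightarrow> real"
  assumes h: "h > 0" and an: "real_analytic_at g h"
    and g: "\<And>b. 0 < b \<Longrightarrow> b < h \<Longrightarrow> g absolutely_integrable_on {0..b}"
    and \<beta>: "\<beta> > -1"
  shows fractional_integral_integrable:
      "(\<lambda>v. g v * (h - v) powr \<beta>) absolutely_integrable_on {0..h}"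
    and fractional_integral_analytic: "real_analytic_at (fractional_integral \<beta> g) h"
    and fractional_integral_has_derivative:
      "\<beta> > 0 \<Longrightarrow> (fractional_integral \<beta> g has_real_derivative \<beta> * fractional_integral (\<beta> - 1) g h) (at h)"
proof -
  obtain r where r: "r > 0" "\<And>b. \<bar>b - h\<bar> < r \<Longrightarrow> \<exists>a. \<forall>t. \<bar>t\<bar> < r \<longrightarrow> (\<lambda>n. a n * t ^ n) sums g (b + t)"
    using real_analytic_at_power_series_nearby[OF an] by metis
  \<comment> \<open>Positive and so close to h that the expansion of \<open>g\<close> at
    \<open>b\<close>, whose radius \<open>r\<close> does not depend on \<open>b\<close>, reaches
    beyond h.\<close>
  define b where "b = max (h / 2) (h - r / 2)"
  have b: "0 < b" "b < h" "h - b < r" using h r by (auto simp: b_def)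
  obtain a where a: "\<And>t. \<bar>t\<bar> < r \<Longrightarrow> (\<lambda>n. a n * t ^ n) sums g (b + t)"
    using r(2)[of b] b by auto
  \<comment> \<open>Within \<delta> of h both expansions are valid: |y - h| < h - b for the head and
    y - b < r for the tail.\<close>
  define \<delta> where "\<delta> = min (h - b) (r - (h - b))"
  have \<delta>: "\<delta> > 0" using b by (simp add: \<delta>_def)
  define A where "A \<beta> y = integral {0..b} (\<lambda>v. g v * (y - v) powr \<beta>)" for \<beta> y :: real
  define T where "T \<beta> y = integral {b..y} (\<lambda>v. g v * (y - v) powr \<beta>)" for \<beta> y :: real
  define p where "p \<beta> m = a m * Beta (real m + 1) (\<beta> + 1)" for \<beta> m
  define P where "P \<beta> w = (\<Sum>m. p \<beta> m * w ^ m)" for \<beta> w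
  note head = fractional_integral_head[OF g[OF b(1,2)] b(1,2)]
  have A_sums: "(\<lambda>m. ((\<beta> gchoose m) * A (\<beta> - m) h) * t ^ m) sums A \<beta> (h + t)" if "\<bar>t\<bar> < h - b" for \<beta> t :: real
    unfolding A_def using head(2)[OF that] .
  have P_summable: "summable (\<lambda>m. p \<beta> m * w ^ m)" if \<beta>: "\<beta> > -1" and w: "\<bar>w\<bar> < r" for \<beta> w
  proof -
    obtain w' where w': "\<bar>w\<bar> < w'" "w' < r" using w dense by blast
    have "summable (\<lambda>m. p \<beta> m * w' ^ m)"
      using fractional_integral_tail(2)[OF a _ w'(2) \<beta>] w' unfolding p_def by (auto simp: sums_iff)
    then show ?thesis by (rule powser_inside) (use w' in auto)
  qed
  have T_eq: "T \<beta> (b + w) = w powr (\<beta> + 1) * P \<beta> w" if "\<beta> > -1" "0 < w" "w < r" for \<beta> w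
  proof -
    have "P \<beta> w = w powr - (\<beta> + 1) * T \<beta> (b + w)"
      using fractional_integral_tail(2)[OF a that(2,3,1)] unfolding p_def P_def T_def by (simp add: sums_iff)
    then have "w powr (\<beta> + 1) * P \<beta> w = (w powr (\<beta> + 1) * w powr - (\<beta> + 1)) * T \<beta> (b + w)" by simp
    also have "w powr (\<beta> + 1) * w powr - (\<beta> + 1) = 1" using that by (simp flip: powr_add)
    finally show ?thesis by simp
  qed
  have near: "b < y" "\<bar>y - h\<bar> < h - b" "y - b < r" if "\<bar>y - h\<bar> < \<delta>" for y
    using that by (auto simp: \<delta>_def)
  have int: "(\<lambda>v. g v * (y - v) powr \<beta>) absolutely_integrable_on {0..y}"
    and split: "fractional_integral \<beta> g y = A \<beta> y + (y - b) powr (\<beta> + 1) * P \<beta> (y - b)"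
    if "\<beta> > -1" "\<bar>y - h\<bar> < \<delta>" for \<beta> y
  proof -
    note n = near[OF that(2)]
    have i1: "(\<lambda>v. g v * (y - v) powr \<beta>) absolutely_integrable_on {0..b}"
      using head(1)[of "y - h" \<beta>] n by simp
    have i2: "(\<lambda>v. g v * (y - v) powr \<beta>) absolutely_integrable_on {b..y}"
      using fractional_integral_tail(1)[OF a _ n(3) that(1)] n by simp
    show i: "(\<lambda>v. g v * (y - v) powr \<beta>) absolutely_integrable_on {0..y}"
      using absolutely_integrable_on_combine[OF i1 i2] b n by simp
    have "fractional_integral \<beta> g y = A \<beta> y + T \<beta> y"
      unfolding fractional_integral_def A_def T_def
      by (rule Henstock_Kurzweil_Integration.integral_combine[symmetric])
        (use b n i in \<open>auto simp: absolutely_integrable_on_def\<close>)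
    then show "fractional_integral \<beta> g y = A \<beta> y + (y - b) powr (\<beta> + 1) * P \<beta> (y - b)"
      using T_eq[OF that(1), of "y - b"] n by simp
  qed
  show "(\<lambda>v. g v * (h - v) powr \<beta>) absolutely_integrable_on {0..h}"
    using int[OF \<beta>, of h] \<delta> by simp
  have ev: "\<forall>\<^sub>F y in nhds h. fractional_integral \<beta> g y = A \<beta> y + (y - b) powr (\<beta> + 1) * P \<beta> (y - b)"
    unfolding eventually_nhds_metric using split[OF \<beta>] \<delta> by (auto simp: dist_real_def)
  show "real_analytic_at (fractional_integral \<beta> g) h"
  proof (rule real_analytic_at_cong[OF _ ev], intro real_analytic_at_add real_analytic_at_mult)
    show "real_analytic_at (A \<beta>) h"
      by (rule power_series_real_analytic_at[where r = "h - b" and x = h, OF A_sums]) (use b in auto)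
    show "real_analytic_at (\<lambda>y. (y - b) powr (\<beta> + 1)) h"
    proof (rule power_series_real_analytic_at[where r = "h - b" and x = h])
      show "(\<lambda>m. ((\<beta> + 1) gchoose m) * (h - b) powr (\<beta> + 1 - real m) * t ^ m) sums (h + t - b) powr (\<beta> + 1)"
        if "\<bar>t\<bar> < h - b" for t
        using gen_binomial_real''[OF that, of "\<beta> + 1"] by (simp add: algebra_simps)
    qed (use b in simp)
    show "real_analytic_at (\<lambda>y. P \<beta> (y - b)) h"
    proof (rule power_series_real_analytic_at[where r = r and x = b])
      show "(\<lambda>m. p \<beta> m * t ^ m) sums P \<beta> (b + t - b)" if "\<bar>t\<bar> < r" for t
        using P_summable[OF \<beta> that] unfolding P_def by (simp add: summable_sums)
    qed (use b in simp)
  qed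
  assume "\<beta> > 0"
  define w where "w = h - b"
  have w: "0 < w" "w < r" using b by (auto simp: w_def)
  have dA: "(A \<beta> has_real_derivative \<beta> * A (\<beta> - 1) h) (at h)"
  proof -
    have "((\<lambda>t. \<Sum>m. ((\<beta> gchoose m) * A (\<beta> - m) h) * t ^ m) has_real_derivative
       (\<Sum>m. diffs (\<lambda>m. (\<beta> gchoose m) * A (\<beta> - m) h) m * 0 ^ m)) (at 0)"
      by (rule termdiffs_strong'[of w]) (use A_sums w in \<open>auto simp: w_def sums_iff\<close>)
    then have "((\<lambda>t. \<Sum>m. ((\<beta> gchoose m) * A (\<beta> - m) h) * t ^ m) has_real_derivative \<beta> * A (\<beta> - 1) h) (at 0)"
      by (simp add: powser_zero diffs_def)
    then have "((\<lambda>t. A \<beta> (h + t)) has_real_derivative \<beta> * A (\<beta> - 1) h) (at 0)"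
      by (rule has_field_derivative_transform_within_open[where S = "ball 0 w"])
        (use A_sums w in \<open>auto simp: w_def sums_iff\<close>)
    then show ?thesis
      using DERIV_shift[of "A \<beta>" _ 0 h] by (simp add: add.commute)
  qed
  have dP: "(P \<beta> has_real_derivative (\<Sum>m. diffs (p \<beta>) m * w ^ m)) (at w)"
    unfolding P_def[abs_def]
    by (rule termdiffs_strong'[of r]) (use P_summable \<beta> w in auto)
  have dQ: "((\<lambda>y. P \<beta> (y - b)) has_real_derivative (\<Sum>m. diffs (p \<beta>) m * w ^ m) * 1) (at h)"
    by (rule DERIV_chain2[where f = "P \<beta>"]) (use dP in \<open>auto simp: w_def intro!: derivative_eq_intros\<close>)
  have dW: "((\<lambda>y. (y - b) powr (\<beta> + 1)) has_real_derivative (\<beta> + 1) * w powr \<beta>) (at h)"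
    using w unfolding w_def by (auto intro!: derivative_eq_intros simp: field_simps powr_diff)
  have D: "((\<lambda>y. A \<beta> y + (y - b) powr (\<beta> + 1) * P \<beta> (y - b)) has_real_derivative
      \<beta> * A (\<beta> - 1) h + ((\<beta> + 1) * w powr \<beta> * P \<beta> w + w powr (\<beta> + 1) * (\<Sum>m. diffs (p \<beta>) m * w ^ m))) (at h)"
    using DERIV_add[OF dA DERIV_mult[OF dW dQ]] by (simp add: w_def mult_ac)
  have "(\<lambda>m. diffs (p \<beta>) m * w ^ m) sums (\<Sum>m. diffs (p \<beta>) m * w ^ m)"
    by (intro summable_sums termdiff_converges[of _ r]) (use P_summable \<beta> w in auto)
  from sums_mult[OF this, of w]
  have "(\<lambda>m. real (Suc m) * p \<beta> (Suc m) * w ^ Suc m) sums (w * (\<Sum>m. diffs (p \<beta>) m * w ^ m))"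
    by (simp add: diffs_def mult_ac)
  \<comment> \<open>The term m = 0 is zero, so the shifted series can be added to that of
    \<open>P\<close> index by index.\<close>
  then have s1: "(\<lambda>m. real m * p \<beta> m * w ^ m) sums (w * (\<Sum>m. diffs (p \<beta>) m * w ^ m))"
    by (subst (asm) sums_Suc_iff) simp
  have "(\<lambda>m. (\<beta> + 1) * (p \<beta> m * w ^ m)) sums ((\<beta> + 1) * P \<beta> w)"
    unfolding P_def by (intro sums_mult summable_sums P_summable) (use \<beta> w in auto)
  from sums_add[OF this s1]
  have "(\<lambda>m. (\<beta> + 1) * (p \<beta> m * w ^ m) + real m * p \<beta> m * w ^ m) sums
    ((\<beta> + 1) * P \<beta> w + w * (\<Sum>m. diffs (p \<beta>) m * w ^ m))" .
  \<comment> \<open>The Beta recurrence (x + z) B(x, z + 1) = z B(x, z) at x = m + 1, z = \<beta>: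
    in the tail this is what lowering the exponent amounts to.\<close>
  moreover have "(\<beta> + 1) * (p \<beta> m * w ^ m) + real m * p \<beta> m * w ^ m = \<beta> * (p (\<beta> - 1) m * w ^ m)" for m
  proof -
    have "\<beta> \<notin> \<int>\<^sub>\<le>\<^sub>0" using \<open>\<beta> > 0\<close> by (auto elim!: nonpos_Ints_cases)
    from Beta_plus1_right[OF this, of "real m + 1"]
    have "(real m + 1 + \<beta>) * Beta (real m + 1) (\<beta> + 1) * (a m * w ^ m)
        = \<beta> * Beta (real m + 1) \<beta> * (a m * w ^ m)" by simp
    then show ?thesis by (simp add: p_def algebra_simps)
  qed
  ultimately have "(\<lambda>m. \<beta> * (p (\<beta> - 1) m * w ^ m)) sums ((\<beta> + 1) * P \<beta> w + w * (\<Sum>m. diffs (p \<beta>) m * w ^ m))"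
    by simp
  moreover have "(\<lambda>m. \<beta> * (p (\<beta> - 1) m * w ^ m)) sums (\<beta> * P (\<beta> - 1) w)"
    unfolding P_def by (intro sums_mult summable_sums P_summable) (use \<open>\<beta> > 0\<close> w in auto)
  ultimately have "(\<beta> + 1) * P \<beta> w + w * (\<Sum>m. diffs (p \<beta>) m * w ^ m) = \<beta> * P (\<beta> - 1) w"
    by (rule sums_unique2)
  then have "w powr \<beta> * ((\<beta> + 1) * P \<beta> w + w * (\<Sum>m. diffs (p \<beta>) m * w ^ m)) = w powr \<beta> * (\<beta> * P (\<beta> - 1) w)"
    by simp
  then have "\<beta> * A (\<beta> - 1) h + ((\<beta> + 1) * w powr \<beta> * P \<beta> w + w powr (\<beta> + 1) * (\<Sum>m. diffs (p \<beta>) m * w ^ m))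
    = \<beta> * (A (\<beta> - 1) h + w powr \<beta> * P (\<beta> - 1) w)"
    using w by (simp add: powr_add algebra_simps)
  also have "\<dots> = \<beta> * fractional_integral (\<beta> - 1) g h"
    using split[of "\<beta> - 1" h] \<open>\<beta> > 0\<close> \<delta> by (simp add: w_def)
  finally show "(fractional_integral \<beta> g has_real_derivative \<beta> * fractional_integral (\<beta> - 1) g h) (at h)"
    using D DERIV_cong_ev[OF refl ev refl] by simp
qed

text \<open>Passing from derivative i to i + 1 needs \<beta> - i > 0, which is the same as \<beta> -
  (i + 1) > -1. Hence the formula lasts as long as the exponent stays above -1.\<close>

lemma higher_deriv_fractional_integral:
  fixes g :: "real \<Rightarrow> real"
  assumes "open V" and pos: "\<And>h. h \<in> V \<Longrightarrow> h > 0"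
    and an: "\<And>h. h \<in> V \<Longrightarrow> real_analytic_at g h"
    and g: "\<And>b h. h \<in> V \<Longrightarrow> 0 < b \<Longrightarrow> b < h \<Longrightarrow> g absolutely_integrable_on {0..b}"
    and F: "\<And>h. h \<in> V \<Longrightarrow> F h = fractional_integral \<beta> g h"
    and "h \<in> V" "\<beta> - real i > -1"
  shows "(deriv ^^ i) F h = (\<Prod>q<i. \<beta> - real q) * fractional_integral (\<beta> - real i) g h"
  using assms(6,7)
proof (induction i arbitrary: h)
  case (Suc i)
  have "\<forall>\<^sub>F y in nhds h. y \<in> V" using Suc.prems \<open>open V\<close> eventually_nhds_in_open by blast
  then have "\<forall>\<^sub>F y in nhds h. (deriv ^^ i) F y = (\<Prod>q<i. \<beta> - real q) * fractional_integral (\<beta> - real i) g y"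
    by eventually_elim (rule Suc.IH, use Suc.prems in auto)
  from deriv_cong_ev[OF this refl]
  have "(deriv ^^ Suc i) F h = deriv (\<lambda>y. (\<Prod>q<i. \<beta> - real q) * fractional_integral (\<beta> - real i) g y) h"
    by simp
  also have "\<dots> = (\<Prod>q<i. \<beta> - real q) * ((\<beta> - real i) * fractional_integral (\<beta> - real i - 1) g h)"
    using Suc.prems pos an g[of h]
    by (intro DERIV_imp_deriv DERIV_cmult fractional_integral_has_derivative) auto
  finally show ?case by (simp add: algebra_simps)
qed (simp add: F)

section \<open>Sign changes and vanishing moments\<close>

lemma continuous_nonzero_constant_sign:
  fixes \<phi> :: "real \<Rightarrow> real"
  assumes "continuous_on {A<..<B} \<phi>" "\<And>v. v \<in> {A<..<B} \<Longrightarrow> \<phi> v \<noteq> 0"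
  obtains e :: real where "e \<in> {1, -1}" "\<And>v. v \<in> {A<..<B} \<Longrightarrow> e * \<phi> v > 0"
proof -
  have conn: "connected (\<phi> ` {A<..<B})"
    using assms(1) by (intro connected_continuous_image) auto
  have "(\<forall>v\<in>{A<..<B}. \<phi> v > 0) \<or> (\<forall>v\<in>{A<..<B}. \<phi> v < 0)"
  proof (rule ccontr)
    assume "\<not> ?thesis"
    then obtain u w where uw: "u \<in> {A<..<B}" "\<phi> u \<le> 0" "w \<in> {A<..<B}" "0 \<le> \<phi> w"
      by (auto simp: not_less)
    then have "0 \<in> \<phi> ` {A<..<B}"
      using connectedD_interval[OF conn, of "\<phi> u" "\<phi> w" 0] by blast
    then show False using assms(2) by fastforce
  qed
  then show ?thesis using that[of 1] that[of "-1"] by force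
qed

text \<open>Induction on the largest zero z: to its left the induction hypothesis gives roots T and
  a sign e, to its right \<phi> has a constant sign d. The point z becomes a root exactly when d and
  e differ. The right end \<open>B\<close> must vary, as it shrinks to z.\<close>

lemma sign_change_polynomial:
  fixes \<phi> :: "real \<Rightarrow> real"
  assumes "finite Z" "continuous_on {A<..<B} \<phi>"
    and "\<And>z. z \<in> Z \<Longrightarrow> \<phi> z = 0" "\<And>v. v \<in> {A<..<B} \<Longrightarrow> \<phi> v = 0 \<Longrightarrow> v \<in> Z"
  shows "\<exists>T e. T \<subseteq> Z \<and> e \<in> {1, -1::real} \<and> (\<forall>v\<in>{A<..<B}. 0 \<le> e * \<phi> v * (\<Prod>t\<in>T. v - t))"
  using assms
proof (induction Z arbitrary: B rule: finite_linorder_max_induct)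
  case empty
  show ?case
  proof -
    obtain e where "e \<in> {1, -1::real}" "\<And>v. v \<in> {A<..<B} \<Longrightarrow> e * \<phi> v > 0"
      by (rule continuous_nonzero_constant_sign[OF empty(1)]) (use empty in blast)+
    then show ?thesis by (intro exI[of _ "{}"] exI[of _ e]) (auto intro: less_imp_le)
  qed
next
  case (insert z S)
  show ?case
  proof (cases "z \<in> {A<..<B}")
    case False
    then have "\<exists>T e. T \<subseteq> S \<and> e \<in> {1, -1::real} \<and> (\<forall>v\<in>{A<..<B}. 0 \<le> e * \<phi> v * (\<Prod>t\<in>T. v - t))"
      using insert.prems by (intro insert.IH) auto
    then show ?thesis by blast
  next
    case True
    have "\<exists>T e. T \<subseteq> S \<and> e \<in> {1, -1::real} \<and> (\<forall>v\<in>{A<..<z}. 0 \<le> e * \<phi> v * (\<Prod>t\<in>T. v - t))"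
    proof (intro insert.IH)
      show "continuous_on {A<..<z} \<phi>"
        using True by (intro continuous_on_subset[OF insert.prems(1)]) auto
      show "v \<in> S" if "v \<in> {A<..<z}" "\<phi> v = 0" for v
        using insert.prems(3)[of v] that True by auto
    qed (use insert.prems in auto)
    then obtain T e where T: "T \<subseteq> S" "e \<in> {1, -1}"
      "\<And>v. v \<in> {A<..<z} \<Longrightarrow> 0 \<le> e * \<phi> v * (\<Prod>t\<in>T. v - t)" by blast
    obtain d where d: "d \<in> {1, -1}" "\<And>v. v \<in> {z<..<B} \<Longrightarrow> d * \<phi> v > 0"
    proof (rule continuous_nonzero_constant_sign)
      show "continuous_on {z<..<B} \<phi>"
        using True by (intro continuous_on_subset[OF insert.prems(1)]) auto
      show "\<phi> v \<noteq> 0" if "v \<in> {z<..<B}" for v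
        using insert.prems(3)[of v] insert.hyps(2) that True by force
    qed blast
    have fT: "finite T" "z \<notin> T" using T(1) insert.hyps finite_subset by auto
    have prodpos: "(\<Prod>t\<in>T. v - t) > 0" if "v > z" for v
      using that T(1) insert.hyps by (intro prod_pos) force
    have "\<phi> z = 0" using insert.prems(2) by simp
    have cases: "v \<in> {A<..<z} \<or> v = z \<or> v \<in> {z<..<B}" if "v \<in> {A<..<B}" for v
      using that by auto
    show ?thesis
    proof (cases "d = e")
      case True
      have "0 \<le> e * \<phi> v * (\<Prod>t\<in>T. v - t)" if "v \<in> {A<..<B}" for v
        using cases[OF that] T(3)[of v] d(2)[of v] prodpos[of v] \<open>\<phi> z = 0\<close> True by fastforce
      then show ?thesis using T(1,2) by blast
    next
      case False
      \<comment> \<open>Here d = -e. The factor v - z is negative to the left of z, which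
        compensates for the sign, and positive to the right.\<close>
      have "0 \<le> d * \<phi> v * (\<Prod>t\<in>insert z T. v - t)" if v: "v \<in> {A<..<B}" for v
      proof -
        have eq: "d * \<phi> v * (\<Prod>t\<in>insert z T. v - t) = (d * \<phi> v * (\<Prod>t\<in>T. v - t)) * (v - z)"
          using fT by simp
        consider "v < z" | "v = z" | "v > z" by linarith
        then show ?thesis
        proof cases
          case 1
          have "d = - e" using False d(1) T(2) by auto
          then have "d * \<phi> v * (\<Prod>t\<in>T. v - t) \<le> 0" using T(3)[of v] 1 v by simp
          then show ?thesis unfolding eq using 1 by (simp add: mult_nonpos_nonpos)
        next
          case 3
          then show ?thesis unfolding eq using d(2)[of v] prodpos[of v] v by simp
        qed (use fT in simp)
      qed
      then show ?thesis using T(1) d(1) by (intro exI[of _ "insert z T"] exI[of _ d]) auto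
    qed
  qed
qed

text \<open>If all the moments vanish, then so does the integral of \<open>\<phi>\<close> against
  the weight times the polynomial of degree less than \<open>k\<close> having the sign changes of \<open>\<phi>\<close>.\<close>
lemma fractional_integrals_not_all_zero:
  fixes \<phi> :: "real \<Rightarrow> real"
  assumes h: "h > 0" and cont: "continuous_on {0<..<h} \<phi>"
    and Z: "finite {v \<in> {0<..<h}. \<phi> v = 0}" "card {v \<in> {0<..<h}. \<phi> v = 0} < k"
    and int: "\<And>i. i < k \<Longrightarrow> (\<lambda>v. \<phi> v * (h - v) powr (a - real i)) absolutely_integrable_on {0..h}"
  shows "\<exists>i<k. fractional_integral (a - real i) \<phi> h \<noteq> 0"
proof (rule ccontr)
  assume "\<not> ?thesis"
  then have zero: "integral {0..h} (\<lambda>v. \<phi> v * (h - v) powr (a - real i)) = 0" if "i < k" for i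
    using that by (auto simp: fractional_integral_def)
  define Z where "Z = {v \<in> {0<..<h}. \<phi> v = 0}"
  have "\<exists>T e. T \<subseteq> Z \<and> e \<in> {1, -1::real} \<and> (\<forall>v\<in>{0<..<h}. 0 \<le> e * \<phi> v * (\<Prod>t\<in>T. v - t))"
    by (rule sign_change_polynomial) (use assms in \<open>auto simp: Z_def\<close>)
  then obtain T e where T: "T \<subseteq> Z" "e \<in> {1, -1}"
    "\<And>v. v \<in> {0<..<h} \<Longrightarrow> 0 \<le> e * \<phi> v * (\<Prod>t\<in>T. v - t)" by blast
  have fT: "finite T" "card T < k"
    using T(1) Z finite_subset card_mono unfolding Z_def by (blast, meson order_le_less_trans)
  \<comment> \<open>The product of the v - t written in the variable h - v, because (h - t) - (h -
    v) = v - t. Each power of h - v then merges with the weight into one of the given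
    exponents.\<close>
  define q where "q = (\<Prod>t\<in>T. [:h - t, -1:])"
  have "degree q \<le> sum (degree \<circ> (\<lambda>t. [:h - t, -1:])) T"
    unfolding q_def by (rule degree_prod_sum_le[OF fT(1)])
  also have "\<dots> \<le> sum (\<lambda>t. 1) T" by (intro sum_mono) simp
  finally have dq: "degree q < k" using fT(2) by simp
  have q: "poly q (h - v) = (\<Prod>t\<in>T. v - t)" for v
    by (simp add: q_def poly_prod)
  define \<psi> where "\<psi> = (\<lambda>v. (e * \<phi> v * (\<Prod>t\<in>T. v - t)) * (h - v) powr (a - real (k - 1)))"
  have \<psi>: "\<psi> v = (\<Sum>i\<le>degree q. (e * coeff q i) * (\<phi> v * (h - v) powr (a - real (k - 1 - i))))"
    if "v \<in> {0..h}" for v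
  proof -
    \<comment> \<open>The identity survives at v = h, where both sides are 0 since
      \<open>0 powr x\<close> is 0 for every x.\<close>
    have *: "(h - v) ^ i * (h - v) powr (a - real (k - 1)) = (h - v) powr (a - real (k - 1 - i))"
      if "i \<le> degree q" for i
    proof (cases "v = h")
      case False
      then have "(h - v) ^ i * (h - v) powr (a - real (k - 1)) = (h - v) powr (real i + (a - real (k - 1)))"
        using \<open>v \<in> {0..h}\<close> by (simp add: powr_add powr_realpow)
      also have "real i + (a - real (k - 1)) = a - real (k - 1 - i)"
        using that dq by (simp add: of_nat_diff)
      finally show ?thesis .
    qed simp
    have "\<psi> v = e * \<phi> v * ((\<Sum>i\<le>degree q. coeff q i * (h - v) ^ i) * (h - v) powr (a - real (k - 1)))"
      unfolding \<psi>_def q[symmetric] by (simp add: poly_altdef)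
    also have "\<dots> = e * \<phi> v * (\<Sum>i\<le>degree q. coeff q i * (h - v) powr (a - real (k - 1 - i)))"
    proof -
      have "(\<Sum>i\<le>degree q. coeff q i * (h - v) ^ i) * (h - v) powr (a - real (k - 1)) =
          (\<Sum>i\<le>degree q. coeff q i * (h - v) powr (a - real (k - 1 - i)))"
        unfolding sum_distrib_right by (intro sum.cong refl) (simp only: mult.assoc *[OF atMost_iff[THEN iffD1]])
      then show ?thesis by simp
    qed
    finally show ?thesis by (simp add: sum_distrib_left mult_ac)
  qed
  have hi: "((\<lambda>v. \<phi> v * (h - v) powr (a - real (k - 1 - i))) has_integral 0) {0..h}" if "i \<le> degree q" for i
    using int[of "k - 1 - i"] zero[of "k - 1 - i"] that dq
    by (auto simp: has_integral_iff absolutely_integrable_on_def)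
  have "((\<lambda>v. \<Sum>i\<le>degree q. (e * coeff q i) * (\<phi> v * (h - v) powr (a - real (k - 1 - i)))) has_integral
    (\<Sum>i\<le>degree q. (e * coeff q i) * 0)) {0..h}"
    by (intro has_integral_sum has_integral_mult_right hi) auto
  then have "(\<psi> has_integral (\<Sum>i\<le>degree q. (e * coeff q i) * 0)) {0..h}"
    by (subst has_integral_cong[OF \<psi>])
  then have hi0: "(\<psi> has_integral 0) {0<..<h}" by (simp add: has_integral_Icc_iff_Ioo)
  have nonneg: "0 \<le> \<psi> v" if "v \<in> {0<..<h}" for v
    unfolding \<psi>_def using T(3)[OF that] mult_nonneg_nonneg[OF _ powr_ge_zero] by blast
  have ai: "\<psi> absolutely_integrable_on {0<..<h}"
    using hi0 nonneg by (intro nonnegative_absolutely_integrable_1) (auto simp: integrable_on_def)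
  have "(\<integral>v. indicator {0<..<h} v *\<^sub>R \<psi> v \<partial>lebesgue) = 0"
    using set_lebesgue_integral_eq_integral(2)[OF ai] integral_unique[OF hi0]
    unfolding set_lebesgue_integral_def by simp
  moreover have "AE v in lebesgue. 0 \<le> indicator {0<..<h} v *\<^sub>R \<psi> v"
    by (rule AE_I2) (use nonneg in \<open>auto simp: indicator_def\<close>)
  ultimately have "AE v in lebesgue. indicator {0<..<h} v *\<^sub>R \<psi> v = 0"
    using integral_nonneg_eq_0_iff_AE[OF ai[unfolded set_integrable_def]] by simp
  moreover have "Z \<in> null_sets lebesgue"
    using Z(1) unfolding Z_def negligible_iff_null_sets[symmetric] by (rule negligible_finite)
  then have "AE v in lebesgue. v \<notin> Z" by (rule AE_not_in)
  \<comment> \<open>A nonnegative function with integral 0 vanishes almost everywhere, but \<psi>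
    has no zeros in (0, h) outside the finite set \<open>Z\<close>. So the whole interval would be a
    null set.\<close>
  ultimately have "AE v in lebesgue. v \<notin> {0<..<h}"
  proof eventually_elim
    case (elim v)
    show ?case
    proof
      assume v: "v \<in> {0<..<h}"
      then have "\<psi> v = 0" using elim(1) by simp
      moreover have "\<phi> v \<noteq> 0" using v elim(2) by (simp add: Z_def)
      moreover have "(\<Prod>t\<in>T. v - t) \<noteq> 0" using elim(2) T(1) fT by (auto simp: prod_zero_iff)
      ultimately show False using v T(2) by (auto simp: \<psi>_def)
    qed
  qed
  then have "{0<..<h} \<in> null_sets lebesgue" by (subst AE_iff_null_sets) auto
  then show False
    using h open_not_negligible[of "{0<..<h}"] unfolding negligible_iff_null_sets[symmetric] by auto
qed

lemma fractional_integral_sum: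
  assumes "finite A" "\<And>j. j \<in> A \<Longrightarrow> (\<lambda>v. g j v * (h - v) powr \<beta>) absolutely_integrable_on {0..h}"
  shows "fractional_integral \<beta> (\<lambda>v. \<Sum>j\<in>A. c j * g j v) h = (\<Sum>j\<in>A. c j * fractional_integral \<beta> (g j) h)"
proof -
  have "((\<lambda>v. \<Sum>j\<in>A. c j * (g j v * (h - v) powr \<beta>)) has_integral
     (\<Sum>j\<in>A. c j * fractional_integral \<beta> (g j) h)) {0..h}"
    unfolding fractional_integral_def using assms
    by (intro has_integral_sum has_integral_mult_right integrable_integral) (auto simp: absolutely_integrable_on_def)
  from integral_unique[OF this] show ?thesis
    unfolding fractional_integral_def sum_distrib_right by (simp add: mult.assoc)
qed

text \<open>\<open>a > real N - 2\<close> puts even the exponent a - (N - 1) above -1, and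
  \<open>a \<notin> \<nat>\<close> keeps the factors a - p nonzero. Since \<open>V\<close> reaches
  down to 0, the interval (0, h) lies in \<open>V\<close>, where the zeros of combinations of the
  \<open>g j\<close> are bounded.\<close>

theorem ECT_system_fractional_integral:
  fixes g L :: "nat \<Rightarrow> real \<Rightarrow> real"
  assumes V: "open V" "is_interval V" "\<And>h. h \<in> V \<Longrightarrow> h > 0" "\<And>b h. h \<in> V \<Longrightarrow> 0 < b \<Longrightarrow> b < h \<Longrightarrow> b \<in> V"
    and an: "\<And>j h. j < N \<Longrightarrow> h \<in> V \<Longrightarrow> real_analytic_at (g j) h"
    and int: "\<And>j b. j < N \<Longrightarrow> b \<in> V \<Longrightarrow> g j absolutely_integrable_on {0..b}"
    and CT: "\<And>k c j. k \<le> N \<Longrightarrow> j < k \<Longrightarrow> c j \<noteq> 0 \<Longrightarrow>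
      finite {v \<in> V. (\<Sum>j<k. c j * g j v) = 0} \<and> card {v \<in> V. (\<Sum>j<k. c j * g j v) = 0} < k"
    and a: "a \<notin> \<nat>" "a > real N - 2" "a > 0"
    and C: "C \<noteq> 0"
    and L: "\<And>j h. j < N \<Longrightarrow> h \<in> V \<Longrightarrow> L j h = C * fractional_integral a (g j) h"
  shows "ECT_system N L V"
proof (rule ECT_systemI[OF V(1,2)])
  have g: "g j absolutely_integrable_on {0..b}" if "j < N" "h \<in> V" "0 < b" "b < h" for j b h
    using int V(4) that by blast
  show "real_analytic_at (L j) h" if "j < N" "h \<in> V" for j h
  proof (rule real_analytic_at_cong)
    show "real_analytic_at (\<lambda>y. C * fractional_integral a (g j) y) h"
      using that a V(3) an g[OF that]
      by (intro real_analytic_at_mult real_analytic_at_const fractional_integral_analytic) auto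
    have "\<forall>\<^sub>F y in nhds h. y \<in> V" using that V(1) eventually_nhds_in_open by blast
    then show "\<forall>\<^sub>F y in nhds h. L j y = C * fractional_integral a (g j) y"
      by eventually_elim (use that L in auto)
  qed
  fix k h c i
  assume k: "k \<le> N" and h: "h \<in> V" and van: "vanishes_to_order k (\<lambda>y. \<Sum>j<k. c j * L j y) h" and i: "i < k"
  show "c i = 0"
  proof (rule ccontr)
    assume "c i \<noteq> 0"
    define \<phi> where "\<phi> = (\<lambda>v. \<Sum>j<k. C * c j * g j v)"
    have an\<phi>: "real_analytic_at \<phi> y" if "y \<in> V" for y
      unfolding \<phi>_def using an that k by (intro real_analytic_at_sum) auto
    have g\<phi>: "\<phi> absolutely_integrable_on {0..b}" if "y \<in> V" "0 < b" "b < y" for b y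
      unfolding \<phi>_def using g[OF _ that] k by (intro absolutely_integrable_sum set_integrable_mult_right) auto
    have F: "(\<Sum>j<k. c j * L j y) = fractional_integral a \<phi> y" if y: "y \<in> V" for y
    proof -
      have "fractional_integral a \<phi> y = (\<Sum>j<k. C * c j * fractional_integral a (g j) y)"
        unfolding \<phi>_def using V(3) an g[OF _ y] y k a
        by (intro fractional_integral_sum fractional_integral_integrable) auto
      also have "\<dots> = (\<Sum>j<k. c j * L j y)"
        using L y k by (intro sum.cong) auto
      finally show ?thesis ..
    qed
    have gt: "a - real q > -1" if "q < k" for q using that k a by linarith
    have "fractional_integral (a - real q) \<phi> h = 0" if q: "q < k" for q
    proof -
      have "(deriv ^^ q) (\<lambda>y. \<Sum>j<k. c j * L j y) h = (\<Prod>p<q. a - real p) * fractional_integral (a - real q) \<phi> h"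
        by (rule higher_deriv_fractional_integral[OF V(1,3) an\<phi> g\<phi> F h gt[OF q]])
      moreover have "(deriv ^^ q) (\<lambda>y. \<Sum>j<k. c j * L j y) h = 0"
        using van q unfolding vanishes_to_order_def by blast
      moreover have "a - real p \<noteq> 0" for p using a(1) by auto
      ultimately show ?thesis by simp
    qed
    moreover have "\<exists>q<k. fractional_integral (a - real q) \<phi> h \<noteq> 0"
    proof (rule fractional_integrals_not_all_zero)
      show "h > 0" using V(3) h .
      have sub: "{0<..<h} \<subseteq> V" using V(4) h by auto
      show "continuous_on {0<..<h} \<phi>"
        using sub an\<phi> real_analytic_at_isCont by (intro continuous_at_imp_continuous_on) blast
      have "finite {v \<in> V. \<phi> v = 0} \<and> card {v \<in> V. \<phi> v = 0} < k"
        unfolding \<phi>_def by (rule CT[OF k i]) (use C \<open>c i \<noteq> 0\<close> in simp)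
      moreover have "{v \<in> {0<..<h}. \<phi> v = 0} \<subseteq> {v \<in> V. \<phi> v = 0}" using sub by auto
      ultimately show "finite {v \<in> {0<..<h}. \<phi> v = 0}" "card {v \<in> {0<..<h}. \<phi> v = 0} < k"
        using finite_subset card_mono order_le_less_trans by metis+
      show "(\<lambda>v. \<phi> v * (h - v) powr (a - real q)) absolutely_integrable_on {0..h}" if "q < k" for q
        using V(3) an\<phi> g\<phi>[OF h] h gt[OF that] by (intro fractional_integral_integrable) auto
    qed
    ultimately show False by blast
  qed
qed

section \<open>Line integrals along the arcs\<close>

text \<open>On the arc y^2 = (h - v) / chi with v = \<Psi> x, so y^(2s - 1) is ((h - v) / chi) powr
  a up to sign, and dx = dv / \<Psi>'; this explains \<open>G\<close>. The parametrization is
  arbitrary: that it runs through each half monotonically is deduced from injectivity of the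
  arc.\<close>

lemma
  fixes chi \<Psi> \<Psi>' X f :: "real \<Rightarrow> real" and \<gamma> :: "real \<Rightarrow> real \<times> real"
  assumes s: "s > 0" and \<Psi>0: "\<Psi> 0 = 0"
    and cont\<Psi>: "continuous_on {x. 0 \<le> x \<and> ereal x < x\<^sub>r} \<Psi>"
    and \<Psi>': "\<And>x. x \<in> einterval 0 x\<^sub>r \<Longrightarrow> (\<Psi> has_real_derivative \<Psi>' x) (at x)"
    and pos: "\<And>x. x \<in> einterval 0 x\<^sub>r \<Longrightarrow> \<Psi>' x > 0 \<and> chi x > 0"
    and X: "\<And>x. x \<in> einterval 0 x\<^sub>r \<Longrightarrow> X (\<Psi> x) = x"
    and arc: "parametrizes_arc \<gamma> (level_arc 0 x\<^sub>r chi \<Psi> h) pos_y_axis neg_y_axis"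
    and a: "a = (2 * real s - 1) / 2"
    and G: "G = (\<lambda>v. f (X v) / (chi (X v) powr a * \<Psi>' (X v)))"
    and conv: "line_integral_dx_converges_absolutely (\<lambda>(x, y). f x * y ^ (2 * s - 1)) \<gamma>"
  shows level_attained: "\<exists>x\<in>einterval 0 x\<^sub>r. \<Psi> x = h"
    and line_integral_density_integrable:
      "(\<lambda>v. G v * (h - v) powr a) absolutely_integrable_on {0..h}"
    and line_integral_eq_fractional_integral:
      "line_integral_dx (\<lambda>(x, y). f x * y ^ (2 * s - 1)) \<gamma> = 2 * fractional_integral a G h"
proof -
  define x where "x t = fst (\<gamma> t)" for t
  define y where "y t = snd (\<gamma> t)" for t
  define v where "v t = \<Psi> (x t)" for t
  define Q where "Q = dx_pullback (\<lambda>(x, y). f x * y ^ (2 * s - 1)) \<gamma>"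
  define K where "K u = G u * (h - u) powr a" for u
  have valid: "valid_path \<gamma>" and "arc \<gamma>" and img: "\<gamma> ` {0<..<1} = level_arc 0 x\<^sub>r chi \<Psi> h"
    and ends: "x 0 = 0" "y 0 > 0" "x 1 = 0" "y 1 < 0"
    using arc by (auto simp: parametrizes_arc_def pos_y_axis_def neg_y_axis_def pathstart_def pathfinish_def x_def y_def)
  have inj: "t = u" if "x t = x u" "y t = y u" "t \<in> {0..1}" "u \<in> {0..1}" for t u
    using that \<open>arc \<gamma>\<close> unfolding arc_def inj_on_def x_def y_def by (meson prod_eqI)
  obtain S0 where S0: "finite S0" "\<gamma> C1_differentiable_on ({0..1} - S0)" and cont\<gamma>: "continuous_on {0..1} \<gamma>"
    using valid unfolding valid_path_def piecewise_C1_differentiable_on_def by blast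
  obtain D where D: "\<And>t. t \<in> {0..1} - S0 \<Longrightarrow> (\<gamma> has_vector_derivative D t) (at t)"
    using S0(2) unfolding C1_differentiable_on_def by blast
  have contx: "continuous_on {0..1} x" and conty: "continuous_on {0..1} y"
    unfolding x_def y_def using cont\<gamma> by (auto intro: continuous_intros)
  have derx: "(x has_real_derivative fst (D t)) (at t)" if "t \<in> {0..1} - S0" for t
    using bounded_linear.has_vector_derivative[OF bounded_linear_fst D[OF that]]
    by (simp add: x_def[abs_def] has_real_derivative_iff_has_vector_derivative)
  have level: "x t \<in> einterval 0 x\<^sub>r" "chi (x t) * (y t)\<^sup>2 + v t = h" if "t \<in> {0<..<1}" for t
  proof -
    have "\<gamma> t \<in> level_arc 0 x\<^sub>r chi \<Psi> h" using that img by blast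
    then show "x t \<in> einterval 0 x\<^sub>r" "chi (x t) * (y t)\<^sup>2 + v t = h"
      by (auto simp: level_arc_def x_def y_def v_def case_prod_unfold)
  qed
  have \<Psi>pos: "\<Psi> z > 0" if z: "z \<in> einterval 0 x\<^sub>r" for z
  proof -
    have zz: "0 < z" "ereal z < x\<^sub>r" using z by (auto simp: einterval_iff)
    have sub: "w \<in> einterval 0 x\<^sub>r" if "0 < w" "w < z" for w
      using that zz by (auto simp: einterval_iff intro: less_trans[of _ "ereal z"])
    have "\<Psi> 0 < \<Psi> z"
    proof (rule DERIV_pos_imp_increasing_open[OF zz(1)])
      show "\<exists>d. DERIV \<Psi> w :> d \<and> 0 < d" if "0 < w" "w < z" for w
        using \<Psi>' pos sub[OF that] by blast
      show "continuous_on {0..z} \<Psi>"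
        by (rule continuous_on_subset[OF cont\<Psi>]) (auto intro: le_less_trans[OF _ zz(2)])
    qed
    then show ?thesis using \<Psi>0 by simp
  qed
  have xdom: "x t \<in> {x. 0 \<le> x \<and> ereal x < x\<^sub>r}" if "t \<in> {0..1}" for t
  proof (cases "t \<in> {0<..<1}")
    case True
    then show ?thesis using level(1)[OF True] by (auto simp: einterval_iff)
  next
    case False
    then have "t = 0 \<or> t = 1" using that by auto
    moreover have "(0::ereal) < x\<^sub>r"
      using level(1)[of "1/2"] less_trans[of 0 "ereal (x (1/2))" x\<^sub>r] by (simp add: einterval_iff)
    ultimately show ?thesis using ends by (auto simp: zero_ereal_def[symmetric])
  qed
  have contv: "continuous_on {0..1} v"
    unfolding v_def by (rule continuous_on_compose2[OF cont\<Psi> contx]) (use xdom in blast)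
  \<comment> \<open>The path starts above and ends below the x-axis, so it crosses it; at the
    crossing the level equation reads \<Psi> x = h.\<close>
  have "\<exists>t\<ge>0. t \<le> 1 \<and> y t = 0"
    by (rule IVT2') (use ends conty in auto)
  then obtain t0 where t0: "0 \<le> t0" "t0 \<le> 1" "y t0 = 0" by blast
  then have t0': "t0 \<in> {0<..<1}" using ends by (cases "t0 = 0"; cases "t0 = 1") auto
  have vt0: "v t0 = h" using level(2)[OF t0'] t0 by simp
  show "\<exists>x\<in>einterval 0 x\<^sub>r. \<Psi> x = h"
    using level(1)[OF t0'] vt0 unfolding v_def by blast
  have Xv: "X (v t) = x t" if "t \<in> {0<..<1}" for t
    using X level(1)[OF that] unfolding v_def by blast
  \<comment> \<open>y = 0 forces \<Psi> x = h, which determines x, and an arc passes through a point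
    only once. Hence y changes sign at \<open>t0\<close> and nowhere else.\<close>
  have uniq: "t = t0" if "t \<in> {0<..<1}" "y t = 0" for t
  proof -
    have "v t = v t0" using level(2)[OF that(1)] that(2) vt0 by simp
    then have "x t = x t0" using Xv that(1) t0' by metis
    then show ?thesis using inj that t0 t0' by auto
  qed
  have ypos: "y t > 0" if "0 \<le> t" "t < t0" for t
  proof (rule ccontr)
    assume "\<not> 0 < y t"
    then have "\<exists>u\<ge>0. u \<le> t \<and> y u = 0"
      using that t0 ends by (intro IVT2' continuous_on_subset[OF conty]) auto
    then obtain u where u: "0 \<le> u" "u \<le> t" "y u = 0" by blast
    then have "u \<noteq> 0" using ends by auto
    then show False using uniq[of u] u that t0 by auto
  qed
  have yneg: "y t < 0" if "t0 < t" "t \<le> 1" for t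
  proof (rule ccontr)
    assume "\<not> y t < 0"
    then have "\<exists>u\<ge>t. u \<le> 1 \<and> y u = 0"
      using that t0 ends by (intro IVT2' continuous_on_subset[OF conty]) auto
    then obtain u where u: "t \<le> u" "u \<le> 1" "y u = 0" by blast
    then have "u \<noteq> 1" using ends by auto
    then show False using uniq[of u] u that t0 by auto
  qed
  have vend: "v 0 = 0" "v 1 = 0" using ends \<Psi>0 by (auto simp: v_def)
  \<comment> \<open>The number e is the sign of y on the half. On the upper half v runs from 0 to h,
    on the lower half from h to 0, so e * v increases on both and one argument serves twice.\<close>
  have half: "K absolutely_integrable_on {0..h} \<and> integral {A..B} Q = integral {0..h} K"
    if AB: "0 \<le> A" "A < B" "B \<le> 1" and e: "e \<in> {1, -1}"
      and ey: "\<And>t. t \<in> {A<..<B} \<Longrightarrow> e * y t > 0"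
      and vAB: "v A \<in> {0, h}" "v B \<in> {0, h}" "e * v A < e * v B" for A B e
  proof -
    have sub: "t \<in> {0<..<1}" "t \<in> {0..1}" if "t \<in> {A<..<B}" for t using that AB by auto
    have vin: "v t \<in> {0<..<h}" if "t \<in> {A<..<B}" for t
    proof -
      have "y t \<noteq> 0" using ey[OF that] by auto
      then have "chi (x t) * (y t)\<^sup>2 > 0" using pos level(1)[OF sub(1)[OF that]] by simp
      moreover have "v t > 0" using \<Psi>pos level(1)[OF sub(1)[OF that]] unfolding v_def by blast
      ultimately show ?thesis using level(2)[OF sub(1)[OF that]] by simp
    qed
    have injv: "inj_on v {A<..<B}"
    proof (rule inj_onI)
      fix t u assume t: "t \<in> {A<..<B}" and u: "u \<in> {A<..<B}" and eq: "v t = v u"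
      have xeq: "x t = x u" using eq Xv[OF sub(1)[OF t]] Xv[OF sub(1)[OF u]] by simp
      have "chi (x t) * (y t)\<^sup>2 = chi (x t) * (y u)\<^sup>2"
        using level(2)[OF sub(1)[OF t]] level(2)[OF sub(1)[OF u]] eq xeq
        by (metis add_right_cancel)
      moreover have "chi (x t) \<noteq> 0" using pos level(1)[OF sub(1)[OF t]] by fastforce
      ultimately have "(y t)\<^sup>2 = (y u)\<^sup>2" by simp
      then have "y t = y u"
        using ey[OF t] ey[OF u] e by (auto simp: power2_eq_iff)
      then show "t = u" using inj[OF xeq] sub(2)[OF t] sub(2)[OF u] by blast
    qed
    have contv': "continuous_on {A..B} v" using AB by (intro continuous_on_subset[OF contv]) auto
    have vimg: "v ` {A<..<B} = {0<..<h}"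
    proof (intro equalityI subsetI)
      fix u assume u: "u \<in> {0<..<h}"
      have conn: "connected (v ` {A..B})" using contv' by (intro connected_continuous_image) auto
      have "u \<in> v ` {A..B}"
      proof (cases "v A \<le> v B")
        case True
        have "v A \<le> u" "u \<le> v B" using True u vAB by auto
        then show ?thesis using connectedD_interval[OF conn, of "v A" "v B" u] AB by auto
      next
        case False
        have "v B \<le> u" "u \<le> v A" using False u vAB by auto
        then show ?thesis using connectedD_interval[OF conn, of "v B" "v A" u] AB by auto
      qed
      then obtain t where t: "t \<in> {A..B}" "u = v t" by blast
      then have "t \<noteq> A" "t \<noteq> B" using u vAB by auto
      then show "u \<in> v ` {A<..<B}" using t by auto
    qed (use vin in auto)
    define S where "S = {A<..<B} - S0"
    have derv: "(v has_real_derivative \<Psi>' (x t) * fst (D t)) (at t)" if "t \<in> S" for t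
    proof -
      have t: "t \<in> {A<..<B}" "t \<in> {0..1} - S0" using that sub unfolding S_def by auto
      show ?thesis unfolding v_def
        by (rule DERIV_chain2[OF \<Psi>'[OF level(1)[OF sub(1)[OF t(1)]]] derx[OF t(2)]])
    qed
    \<comment> \<open>Otherwise e * v, which ends above its value at t, would take that value again
      on [u, B], against injectivity.\<close>
    have mono: "e * v t < e * v u" if t: "t \<in> {A<..<B}" and u: "u \<in> {A<..<B}" and "t < u" for t u
    proof (rule ccontr)
      assume "\<not> e * v t < e * v u"
      moreover have "e * v t < e * v B"
        using vin[OF t] vAB e by auto
      ultimately have "\<exists>w\<ge>u. w \<le> B \<and> e * v w = e * v t"
        using u by (intro IVT' continuous_on_mult continuous_on_const continuous_on_subset[OF contv']) auto
      then obtain w where w: "u \<le> w" "w \<le> B" "v w = v t" using e by auto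
      have "w \<noteq> B" using w vin[OF t] vAB by auto
      then have "w = t" using inj_onD[OF injv w(3)] w t u by auto
      then show False using w \<open>t < u\<close> by simp
    qed
    \<comment> \<open>Since \<Psi>' > 0, monotonicity of e * v fixes the direction of x. This
      resolves the absolute value in the change of variables.\<close>
    have sign: "e * fst (D t) \<ge> 0" if t: "t \<in> S" for t
    proof (rule ccontr)
      assume "\<not> e * fst (D t) \<ge> 0"
      have t': "t \<in> {A<..<B}" using t by (simp add: S_def)
      have "\<Psi>' (x t) > 0" using pos level(1)[OF sub(1)[OF t']] by blast
      then have "e * (\<Psi>' (x t) * fst (D t)) < 0"
        using \<open>\<not> e * fst (D t) \<ge> 0\<close> by (metis mult.left_commute mult_pos_neg not_le)
      from DERIV_neg_dec_right[OF DERIV_cmult[OF derv[OF t]] this]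
      obtain d where d: "d > 0" "\<And>k. 0 < k \<Longrightarrow> k < d \<Longrightarrow> e * v (t + k) < e * v t" by blast
      define k where "k = min (d / 2) ((B - t) / 2)"
      have k: "0 < k" "k < d" "t + k \<in> {A<..<B}"
        using d(1) t' by (auto simp: k_def min_def field_simps)
      show False using mono[OF t' k(3)] d(2)[OF k(1,2)] k(1) by simp
    qed
    have "open S" unfolding S_def using S0(1) by (intro open_Diff finite_imp_closed) auto
    then have Smeas: "S \<in> sets lebesgue" by (metis borel_open sets_completionI_sets sets_lborel)
    \<comment> \<open>The sign e enters once through the odd power of y and once through |dx|, and e
      * e = 1. Therefore both halves contribute equally, which is the factor 2.\<close>
    have Qeq: "\<bar>\<Psi>' (x t) * fst (D t)\<bar> * K (v t) = Q t" if t: "t \<in> S" for t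
    proof -
      have t': "t \<in> {A<..<B}" "t \<in> {0..1} - S0" using t sub by (auto simp: S_def)
      note lev = level[OF sub(1)[OF t'(1)]]
      have p: "\<Psi>' (x t) > 0" "chi (x t) > 0" using pos lev(1) by auto
      have "(\<gamma> has_vector_derivative D t) (at t within {0..1})"
        using D[OF t'(2)] has_vector_derivative_at_within by blast
      moreover have "t \<in> cbox 0 (1::real)" using t' by simp
      ultimately have "vector_derivative \<gamma> (at t within {0..1}) = D t"
        using vector_derivative_within_cbox[of 0 1 t] by simp
      then have "Q t = f (x t) * y t ^ (2 * s - 1) * fst (D t)"
        by (simp add: Q_def dx_pullback_def x_def y_def case_prod_unfold)
      moreover have "K (v t) = f (x t) * \<bar>y t\<bar> ^ (2 * s - 1) / \<Psi>' (x t)"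
      proof -
        have "h - v t = chi (x t) * (y t)\<^sup>2" using lev(2) by simp
        moreover have "(chi (x t) * (y t)\<^sup>2) powr a = chi (x t) powr a * ((y t)\<^sup>2) powr a"
          using p by (simp add: powr_mult)
        moreover have "((y t)\<^sup>2) powr a = \<bar>y t\<bar> ^ (2 * s - 1)"
        proof -
          have y: "\<bar>y t\<bar> > 0" using ey[OF t'(1)] by auto
          have "((y t)\<^sup>2) powr a = (\<bar>y t\<bar> powr 2) powr a" using y by simp
          also have "\<dots> = \<bar>y t\<bar> powr (2 * a)" by (rule powr_powr)
          also have "2 * a = real (2 * s - 1)" using s by (simp add: a of_nat_diff)
          also have "\<bar>y t\<bar> powr real (2 * s - 1) = \<bar>y t\<bar> ^ (2 * s - 1)" using y by (rule powr_realpow)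
          finally show ?thesis .
        qed
        ultimately show ?thesis
          unfolding K_def G Xv[OF sub(1)[OF t'(1)]] using p by simp
      qed
      moreover have "\<bar>y t\<bar> = e * y t" using ey[OF t'(1)] e by auto
      moreover have "(e * y t) ^ (2 * s - 1) = e * y t ^ (2 * s - 1)"
        using e s by (auto simp: power_mult_distrib odd_pos)
      moreover have "\<bar>fst (D t)\<bar> = e * fst (D t)" using sign[OF t] e by auto
      ultimately show ?thesis using p e by (auto simp: abs_mult)
    qed
    have Qint: "Q absolutely_integrable_on {0..1}"
      using conv unfolding line_integral_dx_converges_absolutely_def Q_def .
    have "Q absolutely_integrable_on S"
      by (rule set_integrable_subset[OF Qint Smeas]) (use sub S_def in auto)
    then have i: "(\<lambda>t. \<bar>\<Psi>' (x t) * fst (D t)\<bar> * K (v t)) absolutely_integrable_on S"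
      by (rule absolutely_integrable_spike[OF _ negligible_empty]) (use Qeq in auto)
    have iS: "integral S (\<lambda>t. \<bar>\<Psi>' (x t) * fst (D t)\<bar> * K (v t)) = integral S Q"
      by (rule integral_cong) (rule Qeq)
    have *: "K absolutely_integrable_on (v ` S) \<and> integral (v ` S) K = integral S Q"
      by (subst has_absolute_integral_change_of_variables_1'[OF Smeas, symmetric, where g' = "\<lambda>t. \<Psi>' (x t) * fst (D t)"])
        (use derv injv i iS in \<open>auto intro: has_field_derivative_at_within inj_on_subset simp: S_def\<close>)
    have "v ` S \<subseteq> {0..h}" using vin by (force simp: S_def)
    \<comment> \<open>What the substitution misses is finite: the two end values and the images of
      the parameters where \<gamma> may fail to be differentiable.\<close>
    have "{0..h} - v ` S \<subseteq> {0, h} \<union> v ` S0"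
    proof
      fix u assume u: "u \<in> {0..h} - v ` S"
      show "u \<in> {0, h} \<union> v ` S0"
      proof (cases "u \<in> {0<..<h}")
        case True
        then obtain t where "t \<in> {A<..<B}" "u = v t" using vimg by blast
        then show ?thesis using u by (auto simp: S_def)
      qed (use u in auto)
    qed
    then have neg: "negligible ({0..h} - v ` S)"
      using S0(1) by (intro negligible_finite) (auto intro: finite_subset)
    have "K absolutely_integrable_on {0..h}"
    proof (subst absolutely_integrable_spike_set_eq[of "{0..h}" "v ` S"])
      show "negligible {u \<in> {0..h} - v ` S. K u \<noteq> 0}" by (rule negligible_subset[OF neg]) auto
      show "negligible {u \<in> v ` S - {0..h}. K u \<noteq> 0}"
        using \<open>v ` S \<subseteq> {0..h}\<close> by (intro negligible_subset[OF negligible_empty]) auto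
    qed (use * in blast)
    moreover have "integral (v ` S) K = integral {0..h} K"
      by (rule integral_subset_negligible[OF \<open>v ` S \<subseteq> {0..h}\<close> neg])
    moreover have "integral S Q = integral {A..B} Q"
    proof (rule integral_subset_negligible)
      show "S \<subseteq> {A..B}" by (auto simp: S_def)
      show "negligible ({A..B} - S)"
        by (rule negligible_subset[of "{A, B} \<union> S0"]) (use S0(1) in \<open>auto simp: S_def\<close>)
    qed
    ultimately show ?thesis using * by simp
  qed
  have h: "h > 0" using \<Psi>pos[OF level(1)[OF t0']] vt0 by (simp add: v_def)
  have 1: "K absolutely_integrable_on {0..h} \<and> integral {0..t0} Q = integral {0..h} K"
    by (rule half[of 0 t0 1]) (use t0' ypos vt0 vend h in auto)
  have 2: "K absolutely_integrable_on {0..h} \<and> integral {t0..1} Q = integral {0..h} K"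
    by (rule half[of t0 1 "-1"]) (use t0' yneg vt0 vend h in auto)
  show "(\<lambda>v. G v * (h - v) powr a) absolutely_integrable_on {0..h}"
    using 1 unfolding K_def by blast
  have "Q integrable_on {0..1}"
    using conv unfolding line_integral_dx_converges_absolutely_def Q_def absolutely_integrable_on_def by blast
  from Henstock_Kurzweil_Integration.integral_combine[OF t0(1,2) this]
  have "integral {0..1} Q = 2 * integral {0..h} K" using 1 2 by simp
  then show "line_integral_dx (\<lambda>(x, y). f x * y ^ (2 * s - 1)) \<gamma> = 2 * fractional_integral a G h"
    unfolding line_integral_dx_def Q_def K_def fractional_integral_def .
qed

section \<open>Inverting the potentials and reflecting left arcs\<close>

lemma is_interval_einterval: "is_interval (einterval a b)"
proof (unfold is_interval_1, intro ballI allI impI)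
  fix p q x assume *: "p \<in> einterval a b" "q \<in> einterval a b" "p \<le> x \<and> x \<le> q"
  then have "a < ereal p" "ereal p \<le> ereal x" "ereal x \<le> ereal q" "ereal q < b"
    by (auto simp: einterval_iff)
  then show "x \<in> einterval a b"
    unfolding einterval_iff by (blast intro: less_le_trans le_less_trans)
qed

text \<open>A local analytic inverse with values in \<open>S\<close> must agree with
  \<open>inv_into S \<Psi>\<close>, because \<Psi> is injective on \<open>S\<close>.\<close>

lemma
  fixes \<Psi> :: "real \<Rightarrow> real"
  assumes "open S" "is_interval S" and an: "\<And>x. x \<in> S \<Longrightarrow> real_analytic_at \<Psi> x"
    and pos: "\<And>x. x \<in> S \<Longrightarrow> deriv \<Psi> x > 0"
  shows inj_on_deriv_pos: "inj_on \<Psi> S"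
    and real_analytic_at_inv_into: "x \<in> S \<Longrightarrow> real_analytic_at (inv_into S \<Psi>) (\<Psi> x)"
    and deriv_inv_into: "x \<in> S \<Longrightarrow> deriv (inv_into S \<Psi>) (\<Psi> x) = 1 / deriv \<Psi> x"
proof -
  have less: "\<Psi> x < \<Psi> y" if "x \<in> S" "y \<in> S" "x < y" for x y
  proof (rule DERIV_pos_imp_increasing[OF that(3)])
    fix z assume "x \<le> z" "z \<le> y"
    then have "z \<in> S" using that assms(2) unfolding is_interval_1 by blast
    then show "\<exists>d. DERIV \<Psi> z :> d \<and> 0 < d"
      using an pos real_analytic_at_has_deriv(1) by blast
  qed
  show inj: "inj_on \<Psi> S"
    by (rule inj_onI) (metis less linorder_neqE_linordered_idom order_less_irrefl)
  assume x: "x \<in> S"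
  obtain e where e: "e > 0" "ball x e \<subseteq> S" using assms(1) x openE by blast
  have "deriv \<Psi> x \<noteq> 0" using pos[OF x] by simp
  then obtain g where g: "real_analytic_at g (\<Psi> x)"
    "\<forall>\<^sub>F w in nhds (\<Psi> x). \<bar>g w - x\<bar> < e \<and> \<Psi> (g w) = w" "deriv g (\<Psi> x) = 1 / deriv \<Psi> x"
    using real_analytic_at_local_inverse[OF an[OF x] _ e(1)] by blast
  have ev: "\<forall>\<^sub>F w in nhds (\<Psi> x). inv_into S \<Psi> w = g w"
    using g(2)
  proof eventually_elim
    case (elim w)
    then have "g w \<in> S" using e(2) by (auto simp: subset_iff dist_real_def abs_minus_commute)
    then show ?case using elim inv_into_f_f[OF inj] by metis
  qed
  show "real_analytic_at (inv_into S \<Psi>) (\<Psi> x)" by (rule real_analytic_at_cong[OF g(1) ev])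
  show "deriv (inv_into S \<Psi>) (\<Psi> x) = 1 / deriv \<Psi> x"
    using deriv_cong_ev[OF ev refl] g(3) by simp
qed

text \<open>The half-turn about the origin also swaps the two halves of the y-axis, so a clockwise
  left arc becomes a clockwise right arc without reversing the path.\<close>

lemma parametrizes_arc_reflect:
  assumes "parametrizes_arc \<gamma> (level_arc x\<^sub>l 0 chi \<Psi> h) neg_y_axis pos_y_axis"
  shows "parametrizes_arc (\<lambda>t. - \<gamma> t) (level_arc 0 (- x\<^sub>l) (\<lambda>x. chi (- x)) (\<lambda>x. \<Psi> (- x)) h) pos_y_axis neg_y_axis"
proof -
  have v: "valid_path \<gamma>" and arc: "arc \<gamma>" and img: "\<gamma> ` {0<..<1} = level_arc x\<^sub>l 0 chi \<Psi> h"
    and ends: "\<gamma> 0 \<in> neg_y_axis" "\<gamma> 1 \<in> pos_y_axis"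
    using assms by (auto simp: parametrizes_arc_def pathstart_def pathfinish_def)
  have "valid_path (\<lambda>t. - \<gamma> t)"
    using v unfolding valid_path_def by (rule piecewise_C1_differentiable_neg)
  moreover have "arc (\<lambda>t. - \<gamma> t)"
    using arc unfolding arc_def path_def inj_on_def by (auto intro: continuous_on_minus)
  moreover have "(\<lambda>t. - \<gamma> t) ` {0<..<1} = level_arc 0 (- x\<^sub>l) (\<lambda>x. chi (- x)) (\<lambda>x. \<Psi> (- x)) h"
  proof -
    have mem: "p \<in> level_arc 0 (- x\<^sub>l) (\<lambda>x. chi (- x)) (\<lambda>x. \<Psi> (- x)) h \<longleftrightarrow> - p \<in> level_arc x\<^sub>l 0 chi \<Psi> h" for p
      by (cases p; cases x\<^sub>l) (auto simp: level_arc_def einterval_iff)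
    have "(\<lambda>t. - \<gamma> t) ` {0<..<1} = uminus ` level_arc x\<^sub>l 0 chi \<Psi> h"
      unfolding img[symmetric] by (simp add: image_image)
    also have "\<dots> = level_arc 0 (- x\<^sub>l) (\<lambda>x. chi (- x)) (\<lambda>x. \<Psi> (- x)) h"
      using mem by (force simp: image_iff)
    finally show ?thesis .
  qed
  moreover have "- \<gamma> 0 \<in> pos_y_axis" "- \<gamma> 1 \<in> neg_y_axis"
    using ends by (auto simp: pos_y_axis_def neg_y_axis_def)
  ultimately show ?thesis
    unfolding parametrizes_arc_def pathstart_def pathfinish_def by blast
qed

text \<open>dx and the odd power of y both change sign, so the pulled-back integrands agree at all
  but finitely many parameters.\<close>

lemma
  fixes f :: "real \<Rightarrow> real"
  assumes "valid_path \<gamma>" "odd k"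
  shows line_integral_dx_reflect:
      "line_integral_dx (\<lambda>(x, y). f (- x) * y ^ k) (\<lambda>t. - \<gamma> t) = line_integral_dx (\<lambda>(x, y). f x * y ^ k) \<gamma>"
    and line_integral_dx_converges_absolutely_reflect:
      "line_integral_dx_converges_absolutely (\<lambda>(x, y). f (- x) * y ^ k) (\<lambda>t. - \<gamma> t) \<longleftrightarrow>
       line_integral_dx_converges_absolutely (\<lambda>(x, y). f x * y ^ k) \<gamma>"
proof -
  obtain S where S: "finite S" "\<gamma> C1_differentiable_on ({0..1} - S)"
    using assms(1) unfolding valid_path_def piecewise_C1_differentiable_on_def by blast
  obtain D where D: "\<And>t. t \<in> {0..1} - S \<Longrightarrow> (\<gamma> has_vector_derivative D t) (at t)"
    using S(2) unfolding C1_differentiable_on_def by blast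
  have eq: "dx_pullback (\<lambda>(x, y). f (- x) * y ^ k) (\<lambda>t. - \<gamma> t) t = dx_pullback (\<lambda>(x, y). f x * y ^ k) \<gamma> t"
    if t: "t \<in> {0..1} - S" for t
  proof -
    have t': "t \<in> cbox 0 (1::real)" using t by simp
    have d: "(\<gamma> has_vector_derivative D t) (at t within {0..1})"
      using D[OF t] has_vector_derivative_at_within by blast
    have "vector_derivative \<gamma> (at t within {0..1}) = D t"
      using vector_derivative_within_cbox[OF _ t', of \<gamma> "D t"] d by simp
    moreover have "vector_derivative (\<lambda>t. - \<gamma> t) (at t within {0..1}) = - D t"
      using vector_derivative_within_cbox[OF _ t', of "\<lambda>t. - \<gamma> t" "- D t"] has_vector_derivative_minus[OF d] by simp
    ultimately show ?thesis using assms(2)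
      by (simp add: dx_pullback_def case_prod_unfold)
  qed
  have neg: "negligible S" using S(1) by (rule negligible_finite)
  show "line_integral_dx (\<lambda>(x, y). f (- x) * y ^ k) (\<lambda>t. - \<gamma> t) = line_integral_dx (\<lambda>(x, y). f x * y ^ k) \<gamma>"
    unfolding line_integral_dx_def by (rule integral_spike[OF neg]) (use eq in simp)
  show "line_integral_dx_converges_absolutely (\<lambda>(x, y). f (- x) * y ^ k) (\<lambda>t. - \<gamma> t) \<longleftrightarrow>
       line_integral_dx_converges_absolutely (\<lambda>(x, y). f x * y ^ k) \<gamma>"
    unfolding line_integral_dx_converges_absolutely_def
    by (rule absolutely_integrable_spike_eq[OF neg]) (use eq in simp)
qed

section \<open>Both families as fractional integrals of the functions of the CT-system\<close>

theorem theorem1p1: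
  fixes n s :: nat
    and x\<^sub>l x\<^sub>r h\<^sub>0 :: ereal
    and \<chi>\<^sub>1 \<Psi>\<^sub>1 \<chi>\<^sub>2 \<Psi>\<^sub>2 \<sigma> :: "real \<Rightarrow> real"
    and c :: real
    and f\<^sub>1 f\<^sub>2 I J L l :: "nat \<Rightarrow> real \<Rightarrow> real"
    and \<gamma>p \<gamma>m :: "real \<Rightarrow> real \<Rightarrow> real \<times> real"
  assumes n: "n > 0" and s: "s > 0"
    and x\<^sub>l: "x\<^sub>l < 0" and x\<^sub>r: "0 < x\<^sub>r" and h\<^sub>0: "0 < h\<^sub>0"
    and analytic_\<chi>\<^sub>1: "real_analytic_on \<chi>\<^sub>1 {x. 0 \<le> x \<and> ereal x < x\<^sub>r}"
    and analytic_\<Psi>\<^sub>1: "real_analytic_on \<Psi>\<^sub>1 {x. 0 \<le> x \<and> ereal x < x\<^sub>r}"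
    and analytic_\<chi>\<^sub>2: "real_analytic_on \<chi>\<^sub>2 {x. x\<^sub>l < ereal x \<and> x \<le> 0}"
    and analytic_\<Psi>\<^sub>2: "real_analytic_on \<Psi>\<^sub>2 {x. x\<^sub>l < ereal x \<and> x \<le> 0}"
    and \<Psi>_zero: "\<Psi>\<^sub>1 0 = 0" "\<Psi>\<^sub>2 0 = 0"
    and right: "\<And>x. x \<in> einterval 0 x\<^sub>r \<Longrightarrow> x * deriv \<Psi>\<^sub>1 x > 0 \<and> \<chi>\<^sub>1 x > 0"
    and left: "\<And>x. x \<in> einterval x\<^sub>l 0 \<Longrightarrow> x * deriv \<Psi>\<^sub>2 x > 0 \<and> \<chi>\<^sub>2 x > 0"
    and \<chi>_lim: "c > 0" "(\<chi>\<^sub>1 \<longlongrightarrow> c) (at_right 0)" "(\<chi>\<^sub>2 \<longlongrightarrow> c) (at_left 0)"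
    and \<Psi>\<^sub>1_lim: "((ereal \<circ> \<Psi>\<^sub>1 \<circ> real_of_ereal) \<longlongrightarrow> h\<^sub>0) (at_left x\<^sub>r)"
    and \<Psi>\<^sub>2_lim: "((ereal \<circ> \<Psi>\<^sub>2 \<circ> real_of_ereal) \<longlongrightarrow> h\<^sub>0) (at_right x\<^sub>l)"
    and arc_right: "\<And>h. h \<in> einterval 0 h\<^sub>0 \<Longrightarrow>
          parametrizes_arc (\<gamma>p h) (level_arc 0 x\<^sub>r \<chi>\<^sub>1 \<Psi>\<^sub>1 h) pos_y_axis neg_y_axis"
    and arc_left: "\<And>h. h \<in> einterval 0 h\<^sub>0 \<Longrightarrow>
          parametrizes_arc (\<gamma>m h) (level_arc x\<^sub>l 0 \<chi>\<^sub>2 \<Psi>\<^sub>2 h) neg_y_axis pos_y_axis"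
    and \<sigma>: "\<sigma> = involution x\<^sub>l x\<^sub>r \<Psi>\<^sub>1 \<Psi>\<^sub>2"
    and analytic_f\<^sub>1: "\<And>i. i < n \<Longrightarrow> real_analytic_on (f\<^sub>1 i) (einterval 0 x\<^sub>r)"
    and analytic_f\<^sub>2: "\<And>i. i < n \<Longrightarrow> real_analytic_on (f\<^sub>2 i) (einterval x\<^sub>l 0)"
    and I_conv: "\<And>i h. i < n \<Longrightarrow> h \<in> einterval 0 h\<^sub>0 \<Longrightarrow>
          line_integral_dx_converges_absolutely (\<lambda>(x, y). f\<^sub>1 i x * y ^ (2 * s - 1)) (\<gamma>p h)"
    and J_conv: "\<And>i h. i < n \<Longrightarrow> h \<in> einterval 0 h\<^sub>0 \<Longrightarrow>
          line_integral_dx_converges_absolutely (\<lambda>(x, y). f\<^sub>2 i x * y ^ (2 * s - 1)) (\<gamma>m h)"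
    and I: "\<And>i h. i < n \<Longrightarrow> h \<in> einterval 0 h\<^sub>0 \<Longrightarrow>
          I i h = line_integral_dx (\<lambda>(x, y). f\<^sub>1 i x * y ^ (2 * s - 1)) (\<gamma>p h)"
    and J: "\<And>i h. i < n \<Longrightarrow> h \<in> einterval 0 h\<^sub>0 \<Longrightarrow>
          J i h = line_integral_dx (\<lambda>(x, y). f\<^sub>2 i x * y ^ (2 * s - 1)) (\<gamma>m h)"
    and L: "\<And>i h. i < 2 * n \<Longrightarrow> h \<in> einterval 0 h\<^sub>0 \<Longrightarrow>
          L i h = (if even i then I (i div 2) h else J ((i - 1) div 2) h)"
    and l: "\<And>i x. i < 2 * n \<Longrightarrow> x \<in> einterval 0 x\<^sub>r \<Longrightarrow>
          l i x = (if even i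
                   then f\<^sub>1 (i div 2) x / \<chi>\<^sub>1 x powr ((2 * real s - 1) / 2)
                   else - (f\<^sub>2 ((i - 1) div 2) (\<sigma> x) / \<chi>\<^sub>2 (\<sigma> x) powr ((2 * real s - 1) / 2))
                          * deriv \<sigma> x)"
    and CT: "CT_system (2 * n) l (einterval 0 x\<^sub>r)"
    and s_large: "s > 2 * (n - 1)"
  shows "ECT_system (2 * n) L (einterval 0 h\<^sub>0)"
proof -
  define a where "a = (2 * real s - 1) / 2"
  define D\<^sub>1 where "D\<^sub>1 = einterval 0 x\<^sub>r"
  define D\<^sub>2 where "D\<^sub>2 = einterval 0 (- x\<^sub>l)"
  define V where "V = einterval 0 h\<^sub>0"
  \<comment> \<open>The left potential after the half-turn; it increases on (0, -x_l), so both sides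
    are handled by the same lemma on right arcs.\<close>
  define \<Psi>m where "\<Psi>m = (\<lambda>x. \<Psi>\<^sub>2 (- x))"
  define X\<^sub>1 where "X\<^sub>1 = inv_into D\<^sub>1 \<Psi>\<^sub>1"
  define Xm where "Xm = inv_into D\<^sub>2 \<Psi>m"
  have D2: "x \<in> D\<^sub>2 \<longleftrightarrow> - x \<in> einterval x\<^sub>l 0" for x
    by (cases x\<^sub>l) (auto simp: D\<^sub>2_def einterval_iff)
  have opens: "open D\<^sub>1" "open D\<^sub>2" "open V" "is_interval D\<^sub>1" "is_interval D\<^sub>2" "is_interval V"
    by (simp_all add: D\<^sub>1_def D\<^sub>2_def V_def is_interval_einterval)
  have Vpos: "h > 0" if "h \<in> V" for h using that by (simp add: V_def einterval_iff)
  have D1pos: "x > 0" if "x \<in> D\<^sub>1" for x using that by (simp add: D\<^sub>1_def einterval_iff)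

  have an1: "real_analytic_at \<Psi>\<^sub>1 x" if "x \<in> D\<^sub>1" for x
  proof (rule real_analytic_on_imp_at[OF analytic_\<Psi>\<^sub>1])
    have "D\<^sub>1 \<subseteq> {x. 0 \<le> x \<and> ereal x < x\<^sub>r}" by (auto simp: D\<^sub>1_def einterval_iff)
    then show "x \<in> interior {x. 0 \<le> x \<and> ereal x < x\<^sub>r}"
      using that opens(1) interior_maximal by blast
  qed
  have an2: "real_analytic_at \<Psi>\<^sub>2 x" if "x \<in> einterval x\<^sub>l 0" for x
  proof (rule real_analytic_on_imp_at[OF analytic_\<Psi>\<^sub>2])
    have "einterval x\<^sub>l 0 \<subseteq> {x. x\<^sub>l < ereal x \<and> x \<le> 0}" by (auto simp: einterval_iff)
    then show "x \<in> interior {x. x\<^sub>l < ereal x \<and> x \<le> 0}"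
      using that open_einterval interior_maximal by blast
  qed
  have d1: "deriv \<Psi>\<^sub>1 x > 0" if "x \<in> D\<^sub>1" for x
    using right[of x] that D1pos[OF that] by (auto simp: D\<^sub>1_def zero_less_mult_iff)
  have d2: "deriv \<Psi>\<^sub>2 x < 0" if "x \<in> einterval x\<^sub>l 0" for x
    using left[OF that] that by (auto simp: einterval_iff zero_less_mult_iff)
  have uminus_an: "real_analytic_at uminus x" for x :: real
    unfolding real_analytic_at_def by (rule exI[of _ uminus]) (auto intro: analytic_intros)
  have anm: "real_analytic_at \<Psi>m x" if "x \<in> D\<^sub>2" for x
    unfolding \<Psi>m_def using an2 that D2 by (intro real_analytic_at_compose[OF uminus_an]) auto
  have derm: "(\<Psi>m has_real_derivative - deriv \<Psi>\<^sub>2 (- x)) (at x)" if "x \<in> D\<^sub>2" for x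
    unfolding \<Psi>m_def
    using DERIV_chain2[OF real_analytic_at_has_deriv(1)[OF an2] DERIV_minus[OF DERIV_ident], of x UNIV] that D2 by simp
  have dm: "deriv \<Psi>m x = - deriv \<Psi>\<^sub>2 (- x)" "deriv \<Psi>m x > 0" if "x \<in> D\<^sub>2" for x
    using DERIV_imp_deriv[OF derm[OF that]] d2[of "- x"] that D2 by auto
  note inv1 = opens(1,4) an1 d1 and invm = opens(2,5) anm dm(2)
  have X1: "X\<^sub>1 (\<Psi>\<^sub>1 x) = x" if "x \<in> D\<^sub>1" for x
    unfolding X\<^sub>1_def using inv_into_f_f[OF inj_on_deriv_pos[OF inv1] that] by simp
  have Xm: "Xm (\<Psi>m x) = x" if "x \<in> D\<^sub>2" for x
    unfolding Xm_def using inv_into_f_f[OF inj_on_deriv_pos[OF invm] that] by simp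
  have cont1: "continuous_on {x. 0 \<le> x \<and> ereal x < x\<^sub>r} \<Psi>\<^sub>1"
    using analytic_\<Psi>\<^sub>1 by (rule real_analytic_on_imp_continuous_on)
  have contm: "continuous_on {x. 0 \<le> x \<and> ereal x < - x\<^sub>l} \<Psi>m"
    unfolding \<Psi>m_def
  proof (rule continuous_on_compose2[OF real_analytic_on_imp_continuous_on[OF analytic_\<Psi>\<^sub>2] continuous_on_minus[OF continuous_on_id]])
    show "uminus ` {x. 0 \<le> x \<and> ereal x < - x\<^sub>l} \<subseteq> {x. x\<^sub>l < ereal x \<and> x \<le> 0}"
      by (cases x\<^sub>l) auto
  qed

  define G\<^sub>1 where "G\<^sub>1 = (\<lambda>i v. f\<^sub>1 i (X\<^sub>1 v) / (\<chi>\<^sub>1 (X\<^sub>1 v) powr a * deriv \<Psi>\<^sub>1 (X\<^sub>1 v)))"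
  define Gm where "Gm = (\<lambda>i v. f\<^sub>2 i (- Xm v) / (\<chi>\<^sub>2 (- Xm v) powr a * deriv \<Psi>m (Xm v)))"
  \<comment> \<open>The densities of the two families in the energy variable, interleaved in the
    same way as \<open>L\<close>.\<close>
  define g where "g j = (if even j then G\<^sub>1 (j div 2) else Gm ((j - 1) div 2))" for j
  have der1: "(\<Psi>\<^sub>1 has_real_derivative deriv \<Psi>\<^sub>1 x) (at x)" "deriv \<Psi>\<^sub>1 x > 0 \<and> \<chi>\<^sub>1 x > 0"
    if "x \<in> einterval 0 x\<^sub>r" for x
    using an1 d1 right that real_analytic_at_has_deriv(1) unfolding D\<^sub>1_def by blast+
  have der2: "(\<Psi>m has_real_derivative deriv \<Psi>m x) (at x)" "deriv \<Psi>m x > 0 \<and> \<chi>\<^sub>2 (- x) > 0"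
    if "x \<in> einterval 0 (- x\<^sub>l)" for x
    using anm dm left that D2 real_analytic_at_has_deriv(1) unfolding D\<^sub>2_def by blast+
  have lm: "\<Psi>m 0 = 0" using \<Psi>_zero by (simp add: \<Psi>m_def)
  have arcm: "parametrizes_arc (\<lambda>t. - \<gamma>m h t) (level_arc 0 (- x\<^sub>l) (\<lambda>x. \<chi>\<^sub>2 (- x)) \<Psi>m h) pos_y_axis neg_y_axis"
    if "h \<in> V" for h
    unfolding \<Psi>m_def using parametrizes_arc_reflect arc_left that V_def by blast
  have validm: "valid_path (\<gamma>m h)" if "h \<in> V" for h
    using arc_left that unfolding V_def parametrizes_arc_def by blast
  have odd: "odd (2 * s - 1)" using s by simp
  have R: "\<exists>x\<in>D\<^sub>1. \<Psi>\<^sub>1 x = h" "(\<lambda>v. G\<^sub>1 i v * (h - v) powr a) absolutely_integrable_on {0..h}"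
    "I i h = 2 * fractional_integral a (G\<^sub>1 i) h" if i: "i < n" and h: "h \<in> V" for i h
  proof -
    have h': "h \<in> einterval 0 h\<^sub>0" using h by (simp add: V_def)
    \<comment> \<open>\<open>meta_eq_to_obj_eq[OF reflexive]\<close> instantiates \<open>G\<close>
      with the right-hand side of its defining equation.\<close>
    note facts = s \<Psi>_zero(1) cont1 der1(1) der1(2) X1[unfolded D\<^sub>1_def] arc_right[OF h'] a_def meta_eq_to_obj_eq[OF reflexive] I_conv[OF i h']
    show "\<exists>x\<in>D\<^sub>1. \<Psi>\<^sub>1 x = h" unfolding D\<^sub>1_def by (rule level_attained[OF facts])
    show "(\<lambda>v. G\<^sub>1 i v * (h - v) powr a) absolutely_integrable_on {0..h}"
      unfolding G\<^sub>1_def by (rule line_integral_density_integrable[OF facts])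
    show "I i h = 2 * fractional_integral a (G\<^sub>1 i) h"
      unfolding I[OF i h'] G\<^sub>1_def by (rule line_integral_eq_fractional_integral[OF facts])
  qed
  have M: "\<exists>x\<in>D\<^sub>2. \<Psi>m x = h" "(\<lambda>v. Gm i v * (h - v) powr a) absolutely_integrable_on {0..h}"
    "J i h = 2 * fractional_integral a (Gm i) h" if i: "i < n" and h: "h \<in> V" for i h
  proof -
    have h': "h \<in> einterval 0 h\<^sub>0" using h by (simp add: V_def)
    have conv: "line_integral_dx_converges_absolutely (\<lambda>(x, y). f\<^sub>2 i (- x) * y ^ (2 * s - 1)) (\<lambda>t. - \<gamma>m h t)"
      using line_integral_dx_converges_absolutely_reflect[OF validm[OF h] odd] J_conv[OF i h'] by blast
    note facts = s lm contm der2(1) der2(2) Xm[unfolded D\<^sub>2_def] arcm[OF h] a_def meta_eq_to_obj_eq[OF reflexive] conv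
    show "\<exists>x\<in>D\<^sub>2. \<Psi>m x = h" unfolding D\<^sub>2_def by (rule level_attained[OF facts])
    show "(\<lambda>v. Gm i v * (h - v) powr a) absolutely_integrable_on {0..h}"
      unfolding Gm_def by (rule line_integral_density_integrable[OF facts])
    have "J i h = line_integral_dx (\<lambda>(x, y). f\<^sub>2 i (- x) * y ^ (2 * s - 1)) (\<lambda>t. - \<gamma>m h t)"
      unfolding J[OF i h'] by (rule line_integral_dx_reflect[OF validm[OF h] odd, symmetric])
    also have "\<dots> = 2 * fractional_integral a (Gm i) h"
      unfolding Gm_def by (rule line_integral_eq_fractional_integral[OF facts])
    finally show "J i h = 2 * fractional_integral a (Gm i) h" .
  qed
  \<comment> \<open>Every energy in \<open>V\<close> is a value of the potential because its arc
    crosses the x-axis; \<open>n\<close> supplies the index 0 < n.\<close>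
  have X1V: "X\<^sub>1 v \<in> D\<^sub>1" "\<Psi>\<^sub>1 (X\<^sub>1 v) = v" if "v \<in> V" for v
    using R(1)[OF n that] X1 by auto
  have XmV: "Xm v \<in> D\<^sub>2" "\<Psi>m (Xm v) = v" if "v \<in> V" for v
    using M(1)[OF n that] Xm by auto
  have anX1: "real_analytic_at X\<^sub>1 v" if "v \<in> V" for v
    using real_analytic_at_inv_into[OF inv1 X1V(1)[OF that]] X1V(2)[OF that] unfolding X\<^sub>1_def by simp
  have anXm: "real_analytic_at Xm v" "deriv Xm v = 1 / deriv \<Psi>m (Xm v)" if "v \<in> V" for v
    using real_analytic_at_inv_into[OF invm XmV(1)[OF that]] deriv_inv_into[OF invm XmV(1)[OF that]]
      XmV(2)[OF that] unfolding Xm_def by simp_all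
  have \<sigma>_eq: "\<sigma> x = - Xm (\<Psi>\<^sub>1 x)" if x: "x \<in> D\<^sub>1" "\<Psi>\<^sub>1 x \<in> V" for x
  proof -
    have "(THE u. u \<in> einterval x\<^sub>l 0 \<and> \<Psi>\<^sub>2 u = \<Psi>\<^sub>1 x) = - Xm (\<Psi>\<^sub>1 x)"
    proof (rule the_equality)
      show "- Xm (\<Psi>\<^sub>1 x) \<in> einterval x\<^sub>l 0 \<and> \<Psi>\<^sub>2 (- Xm (\<Psi>\<^sub>1 x)) = \<Psi>\<^sub>1 x"
        using XmV[OF x(2)] D2 unfolding \<Psi>m_def by simp
      fix u assume u: "u \<in> einterval x\<^sub>l 0 \<and> \<Psi>\<^sub>2 u = \<Psi>\<^sub>1 x"
      then have "Xm (\<Psi>m (- u)) = - u" using D2 by (intro Xm) simp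
      then show "u = - Xm (\<Psi>\<^sub>1 x)" using u by (simp add: \<Psi>m_def)
    qed
    then show ?thesis using D1pos[OF x(1)] by (simp add: \<sigma> involution_def)
  qed
  \<comment> \<open>Chain rule for \<sigma> = - Xm o \<open>\<Psi>\<^sub>1\<close>, valid near the
    point because \<open>\<Psi>\<^sub>1\<close> maps a neighbourhood of it into
    \<open>V\<close>.\<close>
  have \<sigma>_deriv: "deriv \<sigma> (X\<^sub>1 v) = - (deriv \<Psi>\<^sub>1 (X\<^sub>1 v) / deriv \<Psi>m (Xm v))" if v: "v \<in> V" for v
  proof -
    have an: "real_analytic_at \<Psi>\<^sub>1 (X\<^sub>1 v)" using an1 X1V(1)[OF v] .
    have "\<forall>\<^sub>F x in nhds (X\<^sub>1 v). x \<in> D\<^sub>1"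
      using X1V(1)[OF v] opens eventually_nhds_in_open by blast
    moreover have "filterlim \<Psi>\<^sub>1 (nhds v) (nhds (X\<^sub>1 v))"
      using real_analytic_at_isCont[OF an, unfolded isCont_def tendsto_at_iff_tendsto_nhds] X1V(2)[OF v] by simp
    then have "\<forall>\<^sub>F x in nhds (X\<^sub>1 v). \<Psi>\<^sub>1 x \<in> V"
      using eventually_nhds_in_open[OF opens(3) v] eventually_compose_filterlim by blast
    ultimately have "\<forall>\<^sub>F x in nhds (X\<^sub>1 v). \<sigma> x = - Xm (\<Psi>\<^sub>1 x)"
      by eventually_elim (rule \<sigma>_eq)
    from deriv_cong_ev[OF this refl]
    have "deriv \<sigma> (X\<^sub>1 v) = deriv (\<lambda>x. - Xm (\<Psi>\<^sub>1 x)) (X\<^sub>1 v)" .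
    also have "\<dots> = - (deriv Xm v * deriv \<Psi>\<^sub>1 (X\<^sub>1 v))"
    proof (intro DERIV_imp_deriv DERIV_minus)
      show "((\<lambda>x. Xm (\<Psi>\<^sub>1 x)) has_real_derivative deriv Xm v * deriv \<Psi>\<^sub>1 (X\<^sub>1 v)) (at (X\<^sub>1 v))"
        by (rule DERIV_chain2[OF _ real_analytic_at_has_deriv(1)[OF an]])
          (use real_analytic_at_has_deriv(1)[OF anXm(1)[OF v]] X1V(2)[OF v] in simp)
    qed
    finally show ?thesis using anXm(2)[OF v] by simp
  qed
  \<comment> \<open>For odd j the minus sign in \<open>l j\<close> cancels that of the derivative of
    \<sigma>, and dividing by the derivative of \<open>\<Psi>\<^sub>1\<close> leaves exactly the
    density of the reflected arc.\<close>
  have g_eq: "g j v = l j (X\<^sub>1 v) / deriv \<Psi>\<^sub>1 (X\<^sub>1 v)" if j: "j < 2 * n" and v: "v \<in> V" for j v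
  proof -
    note x = X1V[OF v]
    have lx: "l j (X\<^sub>1 v) = (if even j then f\<^sub>1 (j div 2) (X\<^sub>1 v) / \<chi>\<^sub>1 (X\<^sub>1 v) powr a
       else - (f\<^sub>2 ((j - 1) div 2) (\<sigma> (X\<^sub>1 v)) / \<chi>\<^sub>2 (\<sigma> (X\<^sub>1 v)) powr a) * deriv \<sigma> (X\<^sub>1 v))"
      unfolding a_def by (rule l[OF j x(1)[unfolded D\<^sub>1_def]])
    have "\<sigma> (X\<^sub>1 v) = - Xm v" using \<sigma>_eq[OF x(1)] x(2) v by simp
    then show ?thesis
      using d1[OF x(1)] unfolding lx \<sigma>_deriv[OF v] g_def G\<^sub>1_def Gm_def by simp
  qed

  show ?thesis
    unfolding V_def[symmetric]
  proof (rule ECT_system_fractional_integral[OF opens(3,6) Vpos, where g = g and a = a and C = 2])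
    show "b \<in> V" if "h \<in> V" "0 < b" "b < h" for b h
    proof -
      have "ereal b < ereal h" "ereal h < h\<^sub>0" using that by (auto simp: V_def einterval_iff)
      then have "ereal b < h\<^sub>0" by (rule less_trans)
      then show ?thesis using that by (simp add: V_def einterval_iff)
    qed
    show "real_analytic_at (g j) h" if "j < 2 * n" "h \<in> V" for j h
    proof (rule real_analytic_at_cong)
      have "\<forall>\<^sub>F v in nhds h. v \<in> V" using that opens eventually_nhds_in_open by blast
      then show "\<forall>\<^sub>F v in nhds h. g j v = l j (X\<^sub>1 v) / deriv \<Psi>\<^sub>1 (X\<^sub>1 v)"
        by eventually_elim (rule g_eq[OF that(1)])
      have x: "X\<^sub>1 h \<in> D\<^sub>1" using X1V(1)[OF that(2)] .
      have "real_analytic_on (l j) D\<^sub>1" using CT that(1) unfolding CT_system_def D\<^sub>1_def by blast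
      then have anl: "real_analytic_at (l j) (X\<^sub>1 h)"
        using x opens(1) by (intro real_analytic_on_imp_at) (auto simp: interior_open)
      note X1h = anX1[OF that(2)]
      have "deriv \<Psi>\<^sub>1 (X\<^sub>1 h) \<noteq> 0" using d1[OF x] by simp
      then show "real_analytic_at (\<lambda>v. l j (X\<^sub>1 v) / deriv \<Psi>\<^sub>1 (X\<^sub>1 v)) h"
        by (rule real_analytic_at_divide[OF real_analytic_at_compose[OF X1h anl]
              real_analytic_at_compose[OF X1h real_analytic_at_has_deriv(2)[OF an1[OF x]]]])
    qed
    show "g j absolutely_integrable_on {0..b}" if j: "j < 2 * n" and b: "b \<in> V" for j b
    proof -
      \<comment> \<open>Integrability is known only with the weight (h - v) powr a. Taking h beyond
        b keeps the weight positive on [0, b], so it can be divided out.\<close>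
      obtain h where h: "b < h" "h \<in> V"
      proof -
        have "ereal b < h\<^sub>0" using b by (simp add: V_def einterval_iff)
        then obtain h where "ereal b < ereal h" "ereal h < h\<^sub>0" using ereal_dense2 by blast
        moreover have "0 < h" using Vpos[OF b] \<open>ereal b < ereal h\<close> by simp
        ultimately show ?thesis by (intro that[of h]) (auto simp: V_def einterval_iff)
      qed
      have "(j - 1) div 2 < n" "j div 2 < n" using j by auto
      then have "(\<lambda>v. g j v * (h - v) powr a) absolutely_integrable_on {0..h}"
        unfolding g_def using R(2) M(2) h(2) by auto
      then have "(\<lambda>v. g j v * (h - v) powr a) absolutely_integrable_on {0..b}"
        by (rule set_integrable_subset) (use h in auto)
      then have "(\<lambda>v. g j v * (h - v) powr a * (h - v) powr - a) absolutely_integrable_on {0..b}"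
        by (rule absolutely_integrable_mult_continuous) (use h in \<open>auto intro!: continuous_intros\<close>)
      then show ?thesis
      proof (rule absolutely_integrable_spike[OF _ negligible_empty])
        show "g j v = g j v * (h - v) powr a * (h - v) powr - a" if "v \<in> {0..b} - {}" for v
          using that h by (simp add: mult.assoc flip: powr_add)
      qed
    qed
    show "finite {v \<in> V. (\<Sum>j<k. c j * g j v) = 0} \<and> card {v \<in> V. (\<Sum>j<k. c j * g j v) = 0} < k"
      if k: "k \<le> 2 * n" and j: "j < k" "c j \<noteq> 0" for k c j
    proof -
      define Z where "Z = {x \<in> D\<^sub>1. (\<Sum>j<k. c j * l j x) = 0}"
      have "k \<in> {1..2 * n}" using k j by auto
      then have Z: "finite Z" "card Z \<le> k - 1"
        using CT j unfolding CT_system_def Z_def D\<^sub>1_def by blast+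
      have inj: "inj_on X\<^sub>1 {v \<in> V. (\<Sum>j<k. c j * g j v) = 0}"
        by (rule inj_onI) (metis X1V(2) mem_Collect_eq)
      \<comment> \<open>At corresponding points the combinations of the \<open>g j\<close> and of
        the \<open>l j\<close> differ by a positive factor, so the zeros inject into those bounded
        by the CT-system.\<close>
      have sub: "X\<^sub>1 ` {v \<in> V. (\<Sum>j<k. c j * g j v) = 0} \<subseteq> Z"
      proof
        fix x assume "x \<in> X\<^sub>1 ` {v \<in> V. (\<Sum>j<k. c j * g j v) = 0}"
        then obtain v where v: "v \<in> V" "(\<Sum>j<k. c j * g j v) = 0" "x = X\<^sub>1 v" by blast
        have "(\<Sum>j<k. c j * g j v) = (\<Sum>j<k. c j * l j x / deriv \<Psi>\<^sub>1 x)"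
          using g_eq v k by (intro sum.cong) auto
        also have "\<dots> = (\<Sum>j<k. c j * l j x) / deriv \<Psi>\<^sub>1 x" by (rule sum_divide_distrib[symmetric])
        finally show "x \<in> Z" using v d1[of x] X1V(1)[OF v(1)] by (auto simp: Z_def)
      qed
      have "finite {v \<in> V. (\<Sum>j<k. c j * g j v) = 0}"
        using finite_subset[OF sub Z(1)] inj by (rule finite_imageD)
      moreover have "card {v \<in> V. (\<Sum>j<k. c j * g j v) = 0} \<le> card Z"
        by (rule card_inj_on_le[OF inj sub Z(1)])
      ultimately show ?thesis using Z(2) j by linarith
    qed
    show "a \<notin> \<nat>"
    proof
      assume "a \<in> \<nat>"
      then obtain m where "a = real m" by (auto elim: Nats_cases)
      then have "real (2 * s) = real (2 * m + 1)" unfolding a_def by simp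
      then have "2 * s = 2 * m + 1" by (simp only: of_nat_eq_iff)
      then show False by presburger
    qed
    \<comment> \<open>Since n > 0, the truncated subtraction n - 1 is a true one, and integrality
      sharpens the strict inequality to s >= 2n - 1. The half unit lost in a = s - 1/2 still leaves
      a > 2n - 2.\<close>
    have "real s \<ge> 2 * real n - 1"
      using s_large n by linarith
    then show "a > real (2 * n) - 2" by (simp add: a_def)
    show "a > 0" using s by (simp add: a_def)
    show "L j h = 2 * fractional_integral a (g j) h" if "j < 2 * n" "h \<in> V" for j h
    proof -
      have "(j - 1) div 2 < n" "j div 2 < n" using that by auto
      then show ?thesis
        using L[OF that(1) that(2)[unfolded V_def]] R(3) M(3) that(2) by (simp add: g_def)
    qed
  qed simp_all
qed

end
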